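(* Let $n$ be a positive integer and $x=(x_1,\dots,x_n)$. Then $$P^{\mathrm{C}_n}_{(1^n)}(x;t,0)=\sum_{y\in\mathbb{Z}}t^{2y^2-y}\bigl(\dot e_{n-4y}(x)-\dot e_{n+2-4y}(x)\bigr)$$ and $$P^{\mathrm{C}_n}_{(1^n)}(x;t,t)=\sum_{\substack{y\in\mathbb{Z}\\ y\ \mathrm{even}}}t^{y^2-y}\bigl(\dot e_{n-2y}(x)-\dot e_{n+2-2y}(x)\bigr).$$
   Context: $\dot e_r(x)=e_r(x_1,x_1^{-1},\dots,x_n,x_n^{-1})$ is the $r$-th elementary symmetric function in $2n$ variables, equal to $0$ for $r<0$ or $r>2n$. $(1^n)$ is the partition with $n$ parts equal to $1$. For a partition $\lambda$, $l(\lambda)$ is the number of parts and $m_i(\lambda)$ the multiplicity of parts equal to $i$; $(a;t)_m=\prod_{i=0}^{m-1}(1-at^i)$; $v_\lambda(t)=\frac{(t;t)_{n-l(\lambda)}}{(1-t)^{n-l(\lambda)}}\prod_{i\ge1}\frac{(t;t)_{m_i(\lambda)}}{(1-t)^{m_i(\lambda)}}$. Let $W=S_n\ltimes(\mathbb{Z}/2\mathbb{Z})^n$ act on rational functions in $x$ by permuting the $x_i$ and by $x_i\mapsto x_i^{-1}$. For $l(\lambda)\le n$ the $\mathrm{BC}_n$ Hall–Littlewood polynomial is $$P^{\mathrm{BC}_n}_{\lambda}(x;t,s_1,s_2)=\frac{1}{(s_1s_2;t)_{n-l(\lambda)}v_\lambda(t)}\sum_{w\in W}w\Biggl(\prod_{i=1}^n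 x_i^{-\lambda_i}\frac{(1-s_1x_i)(1-s_2x_i)}{1-x_i^2}\prod_{1\le i<j\le n}\frac{(tx_i-x_j)(1-tx_ix_j)}{(x_i-x_j)(1-x_ix_j)}\Biggr),$$ and the $\mathrm{C}_n$ Hall–Littlewood polynomial is $P^{\mathrm{C}_n}_\lambda(x;t,s)=P^{\mathrm{BC}_n}_\lambda(x;t,s^{1/2},-s^{1/2})$. *)

theory Defs
  imports Complex_Main "HOL-Combinatorics.Permutations"
begin

text \<open>
  Rational functions in \<open>x\<^sub>1, \<dots>, x\<^sub>n\<close> are rendered as functions of a point \<open>x :: nat \<Rightarrow> 'a\<close>
  with coordinates in an arbitrary field, of which only the entries \<open>x i\<close> with
  \<open>i \<in> {1..n}\<close> matter.  Taking for \<open>'a\<close> a field of rational functions and for \<open>x i\<close> and the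
  parameters its generators gives the formal objects.  Since division by zero yields zero, the
  values are meaningful only at points where no denominator vanishes.

  A partition is the weakly decreasing list of its (positive) parts.
\<close>

definition qpoch :: "'a::field \<Rightarrow> 'a \<Rightarrow> nat \<Rightarrow> 'a" where
  "qpoch a t m = (\<Prod>i<m. 1 - a * t ^ i)"

definition part :: "nat list \<Rightarrow> nat \<Rightarrow> nat" where
  "part lam i = (if 1 \<le> i \<and> i \<le> length lam then lam ! (i - 1) else 0)"

text \<open>Factors of the product over \<open>i \<ge> 1\<close> with \<open>m\<^sub>i(\<lambda>) = 0\<close> are \<open>1\<close>, so only the \<open>i\<close> that
  occur as parts are kept.\<close>

definition hl_v :: "nat \<Rightarrow> nat list \<Rightarrow> 'a::field \<Rightarrow> 'a" where
  "hl_v n lam t =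
     qpoch t t (n - length lam) / (1 - t) ^ (n - length lam) *
     (\<Prod>i\<in>set lam. qpoch t t (count_list lam i) / (1 - t) ^ count_list lam i)"

text \<open>The pair \<open>(\<pi>, E)\<close> stands for the substitution \<open>x\<^sub>i \<mapsto> x\<^bsub>\<pi>(i)\<^esub>\<close> followed by inversion
  of the entries at the positions in \<open>E\<close>; each element of \<open>W\<close> arises from exactly one such pair.\<close>

definition hyperoct :: "nat \<Rightarrow> ((nat \<Rightarrow> nat) \<times> nat set) set" where
  "hyperoct n = {\<pi>. \<pi> permutes {1..n}} \<times> Pow {1..n}"

definition hyperoct_act ::
  "(nat \<Rightarrow> nat) \<times> nat set \<Rightarrow> ((nat \<Rightarrow> 'a) \<Rightarrow> 'a) \<Rightarrow> (nat \<Rightarrow> 'a::field) \<Rightarrow> 'a" where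
  "hyperoct_act w f x =
     f (\<lambda>i. if i \<in> snd w then inverse (x (fst w i)) else x (fst w i))"

definition hl_summand ::
  "nat \<Rightarrow> nat list \<Rightarrow> 'a \<Rightarrow> 'a \<Rightarrow> 'a \<Rightarrow> (nat \<Rightarrow> 'a) \<Rightarrow> 'a::field" where
  "hl_summand n lam t s1 s2 x =
     (\<Prod>i\<in>{1..n}. x i powi (- int (part lam i)) *
        ((1 - s1 * x i) * (1 - s2 * x i) / (1 - (x i)\<^sup>2))) *
     (\<Prod>i\<in>{1..n}. \<Prod>j\<in>{i<..n}.
        ((t * x i - x j) * (1 - t * x i * x j)) / ((x i - x j) * (1 - x i * x j)))"

definition P_BC ::
  "nat \<Rightarrow> nat list \<Rightarrow> (nat \<Rightarrow> 'a) \<Rightarrow> 'a \<Rightarrow> 'a \<Rightarrow> 'a \<Rightarrow> 'a::field" where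
  "P_BC n lam x t s1 s2 =
     1 / (qpoch (s1 * s2) t (n - length lam) * hl_v n lam t) *
     (\<Sum>w\<in>hyperoct n. hyperoct_act w (hl_summand n lam t s1 s2) x)"

text \<open>The two square roots of \<open>s\<close> give the same value, \<open>P_BC\<close> being symmetric in its last two
  arguments; the definition is meaningful only if \<open>s\<close> has a square root in \<open>'a\<close>.\<close>

definition P_C ::
  "nat \<Rightarrow> nat list \<Rightarrow> (nat \<Rightarrow> 'a) \<Rightarrow> 'a \<Rightarrow> 'a \<Rightarrow> 'a::field" where
  "P_C n lam x t s = (let r = (SOME r. r\<^sup>2 = s) in P_BC n lam x t r (- r))"

definition esym :: "'i set \<Rightarrow> ('i \<Rightarrow> 'a) \<Rightarrow> int \<Rightarrow> 'a::comm_ring_1" where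
  "esym I z r = (if r < 0 then 0 else \<Sum>S | S \<subseteq> I \<and> card S = nat r. \<Prod>i\<in>S. z i)"

definition e_dot :: "nat \<Rightarrow> (nat \<Rightarrow> 'a) \<Rightarrow> int \<Rightarrow> 'a::field" where
  "e_dot n x r = esym ({1..n} <+> {1..n}) (case_sum x (\<lambda>i. inverse (x i))) r"

end

theory Submission
  imports Defs "HOL-Computational_Algebra.Polynomial"
begin

text \<open>
  Summing over permutations first removes the factors \<open>(t x\<^sub>i - x\<^sub>j)/(x\<^sub>i - x\<^sub>j)\<close> and leaves a sum
  \<open>F\<^sub>n(c,d)\<close> over sign changes (\<open>c, d\<close> standing for \<open>s\<^sub>1, s\<^sub>2\<close>).  As a function of
  \<open>y = x\<^bsub>n+1\<^esub>\<close>, \<open>F\<^bsub>n+1\<^esub>\<close> has no poles outside \<open>0, \<infinity>\<close> and is affine in \<open>y + 1/y\<close>; its leading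
  coefficient is \<open>F\<^sub>n(c,d)\<close> and its value at \<open>y = c\<close> is \<open>(1 - c d) F\<^sub>n(t c, d) / c\<close>.
  The Al-Salam--Chihara functional \<open>L\<^bsub>c,d\<^esub>\<close> to base \<open>t\<close> obeys the same recursion, so
  \<open>F\<^sub>n(c,d) = L\<^bsub>c,d\<^esub>(\<Prod>\<^sub>i (x\<^sub>i + 1/x\<^sub>i - v))\<close>.  For \<open>c = d = 0\<close> this is the continuous
  \<open>t\<close>-Hermite functional, which in terms of \<open>v = z + 1/z\<close> extracts coefficients of \<open>z\<close> with
  theta function weights; for \<open>c = -d = \<surd>t\<close> it is the same functional to base \<open>t\<^sup>2\<close>.
\<close>

section \<open>Functions of one variable that agree with polynomials of bounded degree\<close>

definition poly_fun :: "nat \<Rightarrow> ('a::field \<Rightarrow> 'a) \<Rightarrow> bool" where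
  "poly_fun m f \<longleftrightarrow> (\<exists>p. degree p \<le> m \<and> (\<forall>y. f y = poly p y))"

lemma poly_fun_const: "poly_fun 0 (\<lambda>y. a)"
  unfolding poly_fun_def by (intro exI[of _ "[:a:]"]) auto

lemma poly_fun_id: "poly_fun 1 (\<lambda>y. y)"
  unfolding poly_fun_def by (intro exI[of _ "[:0,1:]"]) auto

lemma poly_fun_mono: "poly_fun m f \<Longrightarrow> m \<le> n \<Longrightarrow> poly_fun n f"
  unfolding poly_fun_def using order_trans by blast

lemma poly_fun_add: "poly_fun m f \<Longrightarrow> poly_fun m g \<Longrightarrow> poly_fun m (\<lambda>y. f y + g y)"
  unfolding poly_fun_def by (metis degree_add_le poly_add)

lemma poly_fun_diff: "poly_fun m f \<Longrightarrow> poly_fun m g \<Longrightarrow> poly_fun m (\<lambda>y. f y - g y)"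
  unfolding poly_fun_def by (metis degree_diff_le poly_diff)

lemma poly_fun_mult: "poly_fun m f \<Longrightarrow> poly_fun n g \<Longrightarrow> poly_fun (m + n) (\<lambda>y. f y * g y)"
  unfolding poly_fun_def by (metis degree_mult_le poly_mult add_mono order_trans)

lemma poly_fun_cmult: "poly_fun m f \<Longrightarrow> poly_fun m (\<lambda>y. a * f y)"
  using poly_fun_mult[OF poly_fun_const, of m f a] by simp

lemma poly_fun_sum:
  "(\<And>i. i \<in> A \<Longrightarrow> poly_fun m (f i)) \<Longrightarrow> poly_fun m (\<lambda>y. \<Sum>i\<in>A. f i y)"
  by (induction A rule: infinite_finite_induct)
     (auto intro!: poly_fun_add poly_fun_mono[OF poly_fun_const])

lemma poly_fun_prod:
  "(\<And>i. i \<in> A \<Longrightarrow> poly_fun m (f i)) \<Longrightarrow> poly_fun (m * card A) (\<lambda>y. \<Prod>i\<in>A. f i y)"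
proof (induction A rule: infinite_finite_induct)
  case (insert i A)
  then show ?case using poly_fun_mult[of m "f i" "m * card A"] by simp
qed (auto intro: poly_fun_const)

lemma poly_fun_linear: "poly_fun 1 (\<lambda>y. a + b * y)"
  unfolding poly_fun_def by (intro exI[of _ "[:a,b:]"]) (auto simp: mult.commute)

lemma poly_fun_power: "poly_fun m (\<lambda>y. y ^ m)"
  using poly_fun_prod[of "{..<m}" 1 "\<lambda>i y. y", OF poly_fun_id] by simp

lemma poly_fun_eq_0:
  assumes "poly_fun m f" "\<And>y. y \<in> S \<Longrightarrow> f y = 0" "card S > m"
  shows "f y = 0"
proof -
  obtain p where p: "degree p \<le> m" "\<And>y. f y = poly p y"
    using assms(1) by (auto simp: poly_fun_def)
  have "p = 0"
  proof (rule ccontr)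
    assume "p \<noteq> 0"
    then have "finite {y. poly p y = 0}" "card {y. poly p y = 0} \<le> degree p"
      by (simp_all add: poly_roots_finite card_poly_roots_bound)
    moreover have "S \<subseteq> {y. poly p y = 0}" using assms(2) p by auto
    ultimately show False using assms(3) p(1) card_mono[of "{y. poly p y = 0}" S] by linarith
  qed
  then show ?thesis using p by simp
qed

text \<open>Characteristic zero leaves infinitely many points outside \<open>B\<close>, more than
  any degree bound allows. Finitely many exceptional parameter values are recovered this way
  below.\<close>

lemma poly_fun_eq_generic:
  fixes f :: "'a::field_char_0 \<Rightarrow> 'a"
  assumes "poly_fun m f" "poly_fun m' g" "finite B" "\<And>y. y \<notin> B \<Longrightarrow> f y = g y"
  shows "f y = g y"
proof -
  have inf: "infinite (- B)"
    using assms(3) infinite_UNIV_char_0 finite_compl by blast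
  obtain S where S: "S \<subseteq> - B" "finite S" "card S = Suc (m + m')"
    using infinite_arbitrarily_large[OF inf] by blast
  have "poly_fun (m + m') (\<lambda>y. f y - g y)"
    by (intro poly_fun_diff poly_fun_mono[OF assms(1)] poly_fun_mono[OF assms(2)]) auto
  then have "f y - g y = 0"
    by (rule poly_fun_eq_0[of _ _ S]) (use S assms(4) in auto)
  then show ?thesis by simp
qed

subsection \<open>Symmetrization over permutations\<close>

text \<open>A product over unordered pairs, listed by increasing representatives. General index sets
  occur because variables are split off one at a time.\<close>

definition pair_prod :: "(nat \<Rightarrow> nat \<Rightarrow> 'a::comm_monoid_mult) \<Rightarrow> nat set \<Rightarrow> 'a" where
  "pair_prod g I = (\<Prod>(i, j)\<in>{(i, j). i \<in> I \<and> j \<in> I \<and> i < j}. g i j)"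

lemma pair_prod_empty [simp]: "pair_prod g {} = 1"
  by (simp add: pair_prod_def)

lemma finite_pairs: "finite I \<Longrightarrow> finite {(i, j). i \<in> I \<and> j \<in> I \<and> i < (j::nat)}"
  by (rule finite_subset[of _ "I \<times> I"]) auto

lemma pair_prod_insert:
  assumes "finite I" "k \<notin> I" "\<And>i j. g i j = g j i"
  shows "pair_prod g (insert k I) = (\<Prod>j\<in>I. g k j) * pair_prod g I"
proof -
  let ?P = "\<lambda>I. {(i, j). i \<in> I \<and> j \<in> I \<and> i < (j::nat)}"
  \<comment> \<open>The pairs containing \<open>k\<close>, sorted; since \<open>g\<close> is
    symmetric, \<open>k\<close> may lie anywhere relative to \<open>I\<close>.\<close>
  let ?K = "(\<lambda>j. if j < k then (j, k) else (k, j)) ` I"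
  have U: "?P (insert k I) = ?K \<union> ?P I" 
    using assms(2) by (auto simp: image_iff not_less le_less split: if_splits)
  have D: "?K \<inter> ?P I = {}" using assms(2) by (auto split: if_splits)
  have "(\<Prod>(i, j)\<in>?K. g i j) = (\<Prod>j\<in>I. g k j)"
    by (subst prod.reindex) (auto simp: inj_on_def assms(3)[of _ k] intro!: prod.cong split: if_splits)
  then show ?thesis
    unfolding pair_prod_def U
    by (subst prod.union_disjoint) (use assms(1) D finite_pairs in auto)
qed

lemma pair_prod_permutes:
  assumes "\<pi> permutes I" "\<And>i j. g i j = g j i"
  shows "pair_prod (\<lambda>i j. g (\<pi> i) (\<pi> j)) I = pair_prod g I"
proof -
  \<comment> \<open>\<open>\<pi>\<close> acts on unordered pairs; re-sorting the image gives a
    bijection whose inverse is the same construction for \<open>inv \<pi>\<close>.\<close>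
  let ?s = "\<lambda>\<pi> (i, j). if \<pi> i < \<pi> j then (\<pi> i, \<pi> j) else (\<pi> j, \<pi> (i::nat) :: nat)"
  have ne: "\<pi> i = \<pi> j \<longleftrightarrow> i = j" "inv \<pi> i = inv \<pi> j \<longleftrightarrow> i = j" for i j
    using permutes_inj[OF assms(1)] permutes_inj[OF permutes_inv[OF assms(1)]]
    by (simp_all add: inj_eq)
  have inI: "\<pi> i \<in> I \<longleftrightarrow> i \<in> I" "inv \<pi> i \<in> I \<longleftrightarrow> i \<in> I" for i
    by (rule permutes_in_image[OF assms(1)], rule permutes_in_image[OF permutes_inv[OF assms(1)]])
  have cancel: "\<pi> (inv \<pi> i) = i" "inv \<pi> (\<pi> i) = i" for i
    by (rule permutes_inverses[OF assms(1)])+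
  have step: "?s \<pi> e \<in> {(i, j). i \<in> I \<and> j \<in> I \<and> i < j} \<and> ?s (inv \<pi>) e \<in> {(i, j). i \<in> I \<and> j \<in> I \<and> i < j}"
    if "e \<in> {(i, j). i \<in> I \<and> j \<in> I \<and> i < j}" for e
  proof -
    obtain i j where e: "e = (i, j)" by (cases e)
    have ij: "i \<in> I" "j \<in> I" "i < j" using that unfolding e by auto
    then have "\<pi> i \<noteq> \<pi> j" "inv \<pi> i \<noteq> inv \<pi> j" by (simp_all add: ne)
    then show ?thesis using ij(1,2) by (simp add: e inI)
  qed
  show ?thesis
    unfolding pair_prod_def
  proof (rule prod.reindex_bij_witness[of _ "?s (inv \<pi>)" "?s \<pi>"])
    fix e assume e: "e \<in> {(i, j). i \<in> I \<and> j \<in> I \<and> i < j}"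
    show "?s \<pi> e \<in> {(i, j). i \<in> I \<and> j \<in> I \<and> i < j}" "?s (inv \<pi>) e \<in> {(i, j). i \<in> I \<and> j \<in> I \<and> i < j}"
      by (rule conjunct1[OF step[OF e]], rule conjunct2[OF step[OF e]])
    show "?s \<pi> (?s (inv \<pi>) e) = e" "?s (inv \<pi>) (?s \<pi> e) = e"
      using e by (auto simp: cancel)
    show "(case ?s \<pi> e of (i, j) \<Rightarrow> g i j) = (case e of (i, j) \<Rightarrow> g (\<pi> i) (\<pi> j))"
      using assms(2) by (auto split: prod.splits if_splits)
  qed
qed

lemma pair_prod_atLeastAtMost:
  "pair_prod g {1..n} = (\<Prod>i\<in>{1..n}. \<Prod>j\<in>{i<..n}. g i j)"
  unfolding pair_prod_def
  by (subst prod.Sigma) (auto intro!: prod.cong)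

lemma partial_fraction:
  fixes x a b t :: "'a::field"
  assumes "x \<noteq> a" "x \<noteq> b" "a \<noteq> b"
  shows "x / (x - a) * ((x - t * b) / (x - b)) =
    (a - t * b) / (a - b) * (x / (x - a)) + (1 - t) * b / (b - a) * (x / (x - b))"
proof -
  \<comment> \<open>Each inverse becomes an atom constrained only by its defining relation, which
    leaves a polynomial identity for \<open>algebra\<close>.\<close>
  have "(x - a) * inverse (x - a) = 1" "(x - b) * inverse (x - b) = 1" "(a - b) * inverse (a - b) = 1"
    "(b - a) * inverse (b - a) = 1"
    using assms by auto
  then show ?thesis unfolding divide_inverse by algebra
qed
lemma partial_fraction_coeffs:
  fixes x a b t :: "'a::field"
  assumes "a \<noteq> b"
  shows "(a - t * b) / (a - b) + (1 - t) * b / (b - a) = 1"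
proof -
  have "(a - b) * inverse (a - b) = 1"
    "(b - a) * inverse (b - a) = 1"
    using assms by auto
  then show ?thesis unfolding divide_inverse by algebra
qed

text \<open>The factors in which \<open>a\<close> meets the other indices: the share of the
  permutations that send the last position to \<open>a\<close>. For \<open>a\<close> outside
  \<open>I\<close> it is the full product over \<open>I\<close>.\<close>

definition sym_weight :: "'a::field \<Rightarrow> (nat \<Rightarrow> 'a) \<Rightarrow> nat set \<Rightarrow> nat \<Rightarrow> 'a" where
  "sym_weight t x I a = (\<Prod>j\<in>I - {a}. (x a - t * x j) / (x a - x j))"

lemma sym_weight_insert:
  "finite I \<Longrightarrow> b \<notin> I \<Longrightarrow> a \<noteq> b \<Longrightarrow>
   sym_weight t x (insert b I) a = (x a - t * x b) / (x a - x b) * sym_weight t x I a"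
  by (simp add: sym_weight_def insert_Diff_if)

lemma sym_weight_insert_self:
  "b \<notin> I \<Longrightarrow> sym_weight t x (insert b I) b = sym_weight t x I b"
  by (simp add: sym_weight_def insert_Diff_if)

text \<open>Expand the product of \<open>(z - t * x j) / (z - x j)\<close> over \<open>I\<close> in
  partial fractions in \<open>z\<close>: it tends to 1 at infinity and has residue
  \<open>(1 - t) * x m * sym_weight t x I m\<close> at \<open>x m\<close>. The identity is this
  expansion at \<open>z = x a\<close>.\<close>

lemma sym_weight_partial_fractions:
  assumes "finite I" "inj_on x I" "a \<notin> I" "x a \<notin> x ` I"
  shows "sym_weight t x I a + (1 - t) * (\<Sum>m\<in>I. x m / (x m - x a) * sym_weight t x I m) = 1"
  using assms
proof (induction I arbitrary: a rule: finite_induct)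
  case empty
  then show ?case by (simp add: sym_weight_def)
next
  case (insert b I)
  have ne: "x a \<noteq> x b" "a \<noteq> b" "a \<notin> I" using insert.prems by auto
  have neI: "x m \<noteq> x a" "x m \<noteq> x b" if "m \<in> I" for m
  proof -
    show "x m \<noteq> x a" using insert.prems(3) that by (metis image_eqI insertCI)
    show "x m \<noteq> x b" using inj_onD[OF insert.prems(1), of m b] insert.hyps(2) that by auto
  qed
  define \<alpha> where "\<alpha> = (x a - t * x b) / (x a - x b)"
  define \<beta> where "\<beta> = (1 - t) * x b / (x b - x a)"
  let ?S = "\<lambda>a. \<Sum>m\<in>I. x m / (x m - x a) * sym_weight t x I m"
  have IHa: "sym_weight t x I a + (1 - t) * ?S a = 1"
    using insert.IH[of a] insert.prems by simp
  \<comment> \<open>The hypothesis is used at \<open>b\<close> as well, because separating the poles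
    at \<open>x a\<close> and \<open>x b\<close> produces both sums.\<close>
  have IHb: "sym_weight t x I b + (1 - t) * ?S b = 1"
    using insert.IH[of b] insert.prems insert.hyps neI(2) by (simp add: image_iff)
  have ab: "\<alpha> + \<beta> = 1"
    unfolding \<alpha>_def \<beta>_def by (rule partial_fraction_coeffs[OF ne(1)])
  have pf: "x m / (x m - x a) * ((x m - t * x b) / (x m - x b)) = \<alpha> * (x m / (x m - x a)) + \<beta> * (x m / (x m - x b))"
    if "m \<in> I" for m
    unfolding \<alpha>_def \<beta>_def by (rule partial_fraction) (use neI[OF that] ne in auto)
  have "(\<Sum>m\<in>I. x m / (x m - x a) * sym_weight t x (insert b I) m) =
        (\<Sum>m\<in>I. \<alpha> * (x m / (x m - x a) * sym_weight t x I m) + \<beta> * (x m / (x m - x b) * sym_weight t x I m))"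
  proof (rule sum.cong)
    fix m assume m: "m \<in> I"
    then have "m \<noteq> b" using insert.hyps by auto
    then have "x m / (x m - x a) * sym_weight t x (insert b I) m =
       (x m / (x m - x a) * ((x m - t * x b) / (x m - x b))) * sym_weight t x I m"
      using insert.hyps by (simp add: sym_weight_insert)
    then show "x m / (x m - x a) * sym_weight t x (insert b I) m = \<alpha> * (x m / (x m - x a) * sym_weight t x I m) + \<beta> * (x m / (x m - x b) * sym_weight t x I m)"
      unfolding pf[OF m] by (simp add: algebra_simps)
  qed simp
  also have "\<dots> = \<alpha> * ?S a + \<beta> * ?S b"
    by (simp add: sum.distrib sum_distrib_left)
  finally have "sym_weight t x (insert b I) a + (1 - t) * (\<Sum>m\<in>insert b I. x m / (x m - x a) * sym_weight t x (insert b I) m)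
     = \<alpha> * sym_weight t x I a + (\<beta> * sym_weight t x I b + (1 - t) * (\<alpha> * ?S a + \<beta> * ?S b))"
    using insert.hyps ne
    by (simp add: sym_weight_insert sym_weight_insert_self \<alpha>_def \<beta>_def algebra_simps)
  also have "\<dots> = 1" using IHa IHb ab by algebra
  finally show ?case .
qed

text \<open>Writing each new factor as \<open>t + (1 - t) * (x m / (x m - x b))\<close> gives the
  recursion \<open>S' = t * S + 1\<close> of a geometric sum; the 1 comes from the partial fraction
  identity at \<open>b\<close>.\<close>

lemma sum_sym_weight:
  assumes "finite I" "inj_on x I"
  shows "(\<Sum>a\<in>I. sym_weight t x I a) * (1 - t) = 1 - t ^ card I"
  using assms
proof (induction I rule: finite_induct)
  case (insert b I)
  have "x m \<noteq> x b" if "m \<in> I" for m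
    using insert.prems insert.hyps that by (metis inj_on_eq_iff insertCI)
  then have f: "(x m - t * x b) / (x m - x b) = t + (1 - t) * (x m / (x m - x b))" if "m \<in> I" for m
    using that by (simp add: divide_simps) (simp add: algebra_simps)
  have "(\<Sum>a\<in>I. sym_weight t x (insert b I) a) =
      (\<Sum>m\<in>I. t * sym_weight t x I m + (1 - t) * (x m / (x m - x b) * sym_weight t x I m))"
    by (rule sum.cong, simp, subst sym_weight_insert)
       (use insert.hyps in \<open>auto simp: f algebra_simps\<close>)
  then have "(\<Sum>a\<in>insert b I. sym_weight t x (insert b I) a) =
     t * (\<Sum>a\<in>I. sym_weight t x I a) +
      (sym_weight t x I b + (1 - t) * (\<Sum>m\<in>I. x m / (x m - x b) * sym_weight t x I m))"
    using insert.hyps by (simp add: sym_weight_insert_self sum.distrib sum_distrib_left)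
  also have "\<dots> = t * (\<Sum>a\<in>I. sym_weight t x I a) + 1"
    using insert.prems insert.hyps by (subst sym_weight_partial_fractions) auto
  finally have "(\<Sum>a\<in>insert b I. sym_weight t x (insert b I) a) * (1 - t) =
    t * ((\<Sum>a\<in>I. sym_weight t x I a) * (1 - t)) + (1 - t)" by (simp add: algebra_simps)
  also have "\<dots> = t * (1 - t ^ card I) + (1 - t)" using insert by simp
  finally show ?case using insert.hyps by (simp add: algebra_simps)
qed simp

text \<open>Permutations are grouped by the image \<open>b\<close> of the last position: its factors
  form \<open>sym_weight\<close>, and the rest is the same sum in one variable fewer.\<close>

lemma sum_permutes_pair_prod:
  assumes "inj_on x {1..n}" "t \<noteq> 1"
  shows "(\<Sum>\<pi> | \<pi> permutes {1..n}.
            pair_prod (\<lambda>i j. (t * x (\<pi> i) - x (\<pi> j)) / (x (\<pi> i) - x (\<pi> j))) {1..n}) =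
         qpoch t t n / (1 - t) ^ n"
  using assms
proof (induction n arbitrary: x)
  case 0
  then show ?case by (simp add: qpoch_def)
next
  case (Suc n)
  let ?g = "\<lambda>x i j. (t * x i - x j) / (x i - (x j::'a))"
  have S: "{1..Suc n} = insert (Suc n) {1..n}" by auto
  have split: "pair_prod (?g y) {1..Suc n} = (\<Prod>i\<in>{1..n}. ?g y i (Suc n)) * pair_prod (?g y) {1..n}" for y
  proof -
    have "{i<..Suc n} = insert (Suc n) {i<..n}" if "i \<in> {1..n}" for i using that by auto
    then show ?thesis
      unfolding pair_prod_atLeastAtMost by (simp add: prod.distrib del: times_divide_eq_left)
  qed
  have "(\<Sum>\<pi> | \<pi> permutes {1..Suc n}. pair_prod (?g (\<lambda>i. x (\<pi> i))) {1..Suc n}) =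
    (\<Sum>b\<in>{1..Suc n}. \<Sum>q | q permutes {1..n}.
       pair_prod (?g (\<lambda>i. x ((transpose (Suc n) b \<circ> q) i))) {1..Suc n})"
    unfolding S by (rule sum_over_permutations_insert) auto
  also have "\<dots> = (\<Sum>b\<in>{1..Suc n}. sym_weight t x {1..Suc n} b * (qpoch t t n / (1 - t) ^ n))"
  proof (rule sum.cong)
    fix b assume b: "b \<in> {1..Suc n}"
    \<comment> \<open>The induction hypothesis is applied at this rearranged point, whose last
      coordinate is \<open>x b\<close>.\<close>
    define y where "y = x \<circ> transpose (Suc n) b"
    have tp: "transpose (Suc n) b permutes {1..Suc n}" using b by (intro permutes_swap_id) auto
    have inj: "inj_on y {1..n}"
    proof (rule inj_onI)
      fix i j assume ij: "i \<in> {1..n}" "j \<in> {1..n}" "y i = y j"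
      have "transpose (Suc n) b i \<in> {1..Suc n}" "transpose (Suc n) b j \<in> {1..Suc n}"
        using ij permutes_in_image[OF tp] by auto
      then have "transpose (Suc n) b i = transpose (Suc n) b j"
        using ij Suc.prems(1) by (auto simp: y_def inj_on_def)
      then show "i = j" by (metis transpose_involutory)
    qed
    have img: "transpose (Suc n) b ` {1..n} = {1..Suc n} - {b}"
    proof -
      have "transpose (Suc n) b ` ({1..Suc n} - {Suc n}) = {1..Suc n} - {b}"
        using permutes_image[OF tp] by (subst image_set_diff) (auto simp: inj_transpose)
      moreover have "{1..Suc n} - {Suc n} = {1..n}" by auto
      ultimately show ?thesis by simp
    qed
    have P: "(\<Prod>i\<in>{1..n}. ?g y i (Suc n)) = sym_weight t x {1..Suc n} b" 
    proof -
      have "(\<Prod>i\<in>{1..n}. ?g y i (Suc n)) = (\<Prod>i\<in>{1..n}. (\<lambda>j. (t * x j - x b) / (x j - x b)) (transpose (Suc n) b i))"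
        by (simp add: y_def)
      also have "\<dots> = (\<Prod>j\<in>{1..Suc n} - {b}. (t * x j - x b) / (x j - x b))"
        unfolding img[symmetric] by (subst prod.reindex) (auto intro: inj_on_subset[OF inj_transpose])
      also have "\<dots> = sym_weight t x {1..Suc n} b"
        unfolding sym_weight_def
        by (rule prod.cong) (auto, metis minus_diff_eq minus_divide_divide)
      finally show ?thesis .
    qed
    have "(\<Sum>q | q permutes {1..n}. pair_prod (?g (\<lambda>i. x ((transpose (Suc n) b \<circ> q) i))) {1..Suc n}) =
      (\<Sum>q | q permutes {1..n}. sym_weight t x {1..Suc n} b * pair_prod (?g (\<lambda>i. y (q i))) {1..n})"
    proof (rule sum.cong)
      fix q assume "q \<in> {q. q permutes {1..n}}"
      then have q: "q permutes {1..n}" by simp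
      then have qS: "q (Suc n) = Suc n" by (simp add: permutes_not_in)
      have "pair_prod (?g (\<lambda>i. x ((transpose (Suc n) b \<circ> q) i))) {1..Suc n} =
            (\<Prod>i\<in>{1..n}. ?g y (q i) (Suc n)) * pair_prod (?g (\<lambda>i. y (q i))) {1..n}"
        unfolding split by (simp add: y_def qS)
      also have "(\<Prod>i\<in>{1..n}. ?g y (q i) (Suc n)) = (\<Prod>i\<in>{1..n}. ?g y i (Suc n))"
        by (rule prod.permute[OF q, unfolded o_def, symmetric])
      finally show "pair_prod (?g (\<lambda>i. x ((transpose (Suc n) b \<circ> q) i))) {1..Suc n} =
         sym_weight t x {1..Suc n} b * pair_prod (?g (\<lambda>i. y (q i))) {1..n}" unfolding P .
    qed simp
    also have "\<dots> = sym_weight t x {1..Suc n} b * (qpoch t t n / (1 - t) ^ n)"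
      using Suc.IH[OF inj Suc.prems(2)] by (simp only: sum_distrib_left[symmetric])
    finally show "(\<Sum>q | q permutes {1..n}. pair_prod (?g (\<lambda>i. x ((transpose (Suc n) b \<circ> q) i))) {1..Suc n}) = sym_weight t x {1..Suc n} b * (qpoch t t n / (1 - t) ^ n)" .
  qed simp
  also have "\<dots> = (\<Sum>b\<in>{1..Suc n}. sym_weight t x {1..Suc n} b) * (qpoch t t n / (1 - t) ^ n)"
    by (simp only: sum_distrib_right)
  also have "(\<Sum>b\<in>{1..Suc n}. sym_weight t x {1..Suc n} b) = (1 - t ^ Suc n) / (1 - t)"
    using sum_sym_weight[OF _ Suc.prems(1), of t] Suc.prems(2) by (simp add: eq_divide_eq)
  finally show ?case by (simp add: qpoch_def)
qed

subsection \<open>The sum over sign changes\<close>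

text \<open>Under these conditions no denominator vanishes, and they survive the inversion of any
  coordinates.\<close>

definition regular_on :: "nat set \<Rightarrow> (nat \<Rightarrow> 'a::field) \<Rightarrow> bool" where
  "regular_on I x \<longleftrightarrow> (\<forall>i\<in>I. x i \<noteq> 0 \<and> (x i)\<^sup>2 \<noteq> 1) \<and>
     (\<forall>i\<in>I. \<forall>j\<in>I. i \<noteq> j \<longrightarrow> x i \<noteq> x j \<and> x i * x j \<noteq> 1)"

definition flip :: "nat set \<Rightarrow> (nat \<Rightarrow> 'a::field) \<Rightarrow> nat \<Rightarrow> 'a" where
  "flip E x i = (if i \<in> E then inverse (x i) else x i)"

text \<open>The one-variable factor for a part equal to 1, which accounts for the extra
  \<open>y\<close> in the denominator.\<close>

definition c_factor :: "'a::field \<Rightarrow> 'a \<Rightarrow> 'a \<Rightarrow> 'a" where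
  "c_factor c d y = (1 - c * y) * (1 - d * y) / (y * (1 - y\<^sup>2))"

definition pair_factor :: "'a::field \<Rightarrow> 'a \<Rightarrow> 'a \<Rightarrow> 'a" where
  "pair_factor t y z = (1 - t * y * z) / (1 - y * z)"

lemma pair_factor_commute: "pair_factor t y z = pair_factor t z y"
  by (simp add: pair_factor_def mult_ac)

text \<open>Up to a unit, inverting \<open>y\<close> turns the denominator \<open>1 - y * z\<close>
  into \<open>1 - y * inverse z\<close>. One product of both therefore clears the poles for
  \<open>y\<close> and for \<open>inverse y\<close>.\<close>

lemma pair_factor_inverse:
  assumes "y \<noteq> 0" "z \<noteq> 0" "y \<noteq> z"
  shows "(1 - y * inverse z) * pair_factor t (inverse y) z = t - y * inverse z"
proof -
  have "1 - inverse y * z \<noteq> 0" using assms by (simp add: inverse_eq_divide divide_eq_eq)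
  moreover have "y * inverse y = 1" "z * inverse z = 1" using assms by auto
  then have "(1 - y * inverse z) * (1 - t * inverse y * z) = (t - y * inverse z) * (1 - inverse y * z)"
    by algebra
  ultimately show ?thesis
    unfolding pair_factor_def times_divide_eq_right by (simp only: nonzero_divide_eq_eq not_False_eq_True)
qed

text \<open>The same factor clears both values; the sign that appears at \<open>inverse y\<close> is
  the minus sign in \<open>numer_term\<close>.\<close>

lemma c_factor_mult:
  assumes "y \<noteq> 0" "y\<^sup>2 \<noteq> 1"
  shows "y * (1 - y\<^sup>2) * c_factor c d y = (1 - c * y) * (1 - d * y)"
    and "y * (1 - y\<^sup>2) * c_factor c d (inverse y) = - (y\<^sup>2 * (y - c) * (y - d))"
proof -
  show "y * (1 - y\<^sup>2) * c_factor c d y = (1 - c * y) * (1 - d * y)"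
    using assms unfolding c_factor_def by simp
  have "inverse y * (1 - (inverse y)\<^sup>2) \<noteq> 0" using assms by (simp add: power_inverse)
  moreover have "y * inverse y = 1" using assms by simp
  then have "y * (1 - y\<^sup>2) * ((1 - c * inverse y) * (1 - d * inverse y)) =
      - (y\<^sup>2 * (y - c) * (y - d)) * (inverse y * (1 - (inverse y)\<^sup>2))" by algebra
  ultimately show "y * (1 - y\<^sup>2) * c_factor c d (inverse y) = - (y\<^sup>2 * (y - c) * (y - d))"
    unfolding c_factor_def times_divide_eq_right by (simp only: nonzero_divide_eq_eq not_False_eq_True)
qed

definition signed_term :: "'a::field \<Rightarrow> 'a \<Rightarrow> 'a \<Rightarrow> nat set \<Rightarrow> (nat \<Rightarrow> 'a) \<Rightarrow> 'a" where
  "signed_term t c d I x =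
     (\<Prod>i\<in>I. c_factor c d (x i)) * pair_prod (\<lambda>i j. pair_factor t (x i) (x j)) I"

text \<open>The sum \<open>F\<^sub>n(c,d)\<close>, for an arbitrary index set.\<close>

definition signed_sum :: "'a::field \<Rightarrow> 'a \<Rightarrow> 'a \<Rightarrow> nat set \<Rightarrow> (nat \<Rightarrow> 'a) \<Rightarrow> 'a" where
  "signed_sum t c d I x = (\<Sum>E\<in>Pow I. signed_term t c d I (flip E x))"

lemma regular_on_subset: "regular_on I x \<Longrightarrow> J \<subseteq> I \<Longrightarrow> regular_on J x"
  unfolding regular_on_def by blast

lemma inverse_mult_eq_1:
  fixes a b :: "'a::field"
  assumes "a \<noteq> 0" "b \<noteq> 0"
  shows "inverse a * b = 1 \<longleftrightarrow> a = b" "a * inverse b = 1 \<longleftrightarrow> a = b"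
     "inverse a * inverse b = 1 \<longleftrightarrow> a * b = 1" "inverse a = b \<longleftrightarrow> a * b = 1" "a = inverse b \<longleftrightarrow> a * b = 1"
  using assms by (auto simp: field_simps)

lemma regular_on_flip:
  assumes "regular_on I x"
  shows "regular_on I (flip E x)"
proof -
  have "flip E x i \<noteq> 0 \<and> (flip E x i)\<^sup>2 \<noteq> 1" if "i \<in> I" for i
    using that assms by (simp add: regular_on_def flip_def power_inverse)
  moreover have "flip E x i \<noteq> flip E x j \<and> flip E x i * flip E x j \<noteq> 1"
    if "i \<in> I" "j \<in> I" "i \<noteq> j" for i j
    using that assms by (simp add: regular_on_def flip_def inverse_mult_eq_1)
  ultimately show ?thesis unfolding regular_on_def by blast
qed

lemma signed_term_cong:
  "(\<And>i. i \<in> I \<Longrightarrow> x i = y i) \<Longrightarrow> signed_term t c d I x = signed_term t c d I y"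
  unfolding signed_term_def pair_prod_def
  by (intro arg_cong2[of _ _ _ _ "(*)"] prod.cong) auto

lemma signed_term_insert:
  "finite I \<Longrightarrow> k \<notin> I \<Longrightarrow> signed_term t c d (insert k I) x =
     c_factor c d (x k) * (\<Prod>j\<in>I. pair_factor t (x k) (x j)) * signed_term t c d I x"
  unfolding signed_term_def
  by (subst pair_prod_insert) (auto simp: pair_factor_commute)

lemma sum_Pow_insert:
  assumes "finite I" "k \<notin> I"
  shows "(\<Sum>E\<in>Pow (insert k I). f E) = (\<Sum>E\<in>Pow I. f E + f (insert k E))"
proof -
  have "(\<Sum>E\<in>insert k ` Pow I. f E) = (\<Sum>E\<in>Pow I. f (insert k E))"
    by (rule sum.reindex_cong[of "insert k"]) (use assms(2) in \<open>auto simp: inj_on_def insert_ident\<close>)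
  moreover have "(\<Sum>E\<in>Pow (insert k I). f E) = (\<Sum>E\<in>Pow I. f E) + (\<Sum>E\<in>insert k ` Pow I. f E)"
    unfolding Pow_insert using assms by (intro sum.union_disjoint) auto
  ultimately show ?thesis by (simp add: sum.distrib)
qed

lemma flip_fresh: "E \<subseteq> I \<Longrightarrow> k \<notin> I \<Longrightarrow> flip E x k = x k"
  "flip (insert k E) x k = inverse (x k)"
  "j \<noteq> k \<Longrightarrow> flip (insert k E) x j = flip E x j"
  by (auto simp: flip_def)

lemma signed_term_flip_insert:
  assumes "finite I" "k \<notin> I" "E \<subseteq> I"
  shows "signed_term t c d (insert k I) (flip E x) =
      c_factor c d (x k) * (\<Prod>j\<in>I. pair_factor t (x k) (flip E x j)) * signed_term t c d I (flip E x)"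
    and "signed_term t c d (insert k I) (flip (insert k E) x) =
      c_factor c d (inverse (x k)) * (\<Prod>j\<in>I. pair_factor t (inverse (x k)) (flip E x j)) *
      signed_term t c d I (flip E x)"
proof -
  have *: "flip (insert k E) x j = flip E x j" if "j \<in> I" for j
    using that assms(2) by (intro flip_fresh(3)) auto
  show "signed_term t c d (insert k I) (flip E x) =
      c_factor c d (x k) * (\<Prod>j\<in>I. pair_factor t (x k) (flip E x j)) * signed_term t c d I (flip E x)"
    using assms by (simp add: signed_term_insert flip_fresh(1))
  show "signed_term t c d (insert k I) (flip (insert k E) x) =
      c_factor c d (inverse (x k)) * (\<Prod>j\<in>I. pair_factor t (inverse (x k)) (flip E x j)) *
      signed_term t c d I (flip E x)"
    using assms(1,2) by (simp add: signed_term_insert flip_fresh(2) * signed_term_cong[OF *] cong: prod.cong)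
qed

lemma signed_sum_insert:
  assumes "finite I" "k \<notin> I"
  shows "signed_sum t c d (insert k I) x =
    (\<Sum>E\<in>Pow I. signed_term t c d I (flip E x) *
       (c_factor c d (x k) * (\<Prod>j\<in>I. pair_factor t (x k) (flip E x j)) +
        c_factor c d (inverse (x k)) * (\<Prod>j\<in>I. pair_factor t (inverse (x k)) (flip E x j))))"
  unfolding signed_sum_def sum_Pow_insert[OF assms]
  by (rule sum.cong) (auto simp: signed_term_flip_insert[OF assms] algebra_simps)

section \<open>The numerator as a polynomial in the added variable\<close>

text \<open>\<open>numer\<close> is the signed sum with a further variable \<open>y\<close>, cleared of the denominators that
  involve \<open>y\<close>; \<open>denom\<close> is the product of the denominators belonging to the old variables.\<close>

definition denom :: "nat set \<Rightarrow> (nat \<Rightarrow> 'a::field) \<Rightarrow> 'a \<Rightarrow> 'a" where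
  "denom I x y = (\<Prod>j\<in>I. (1 - y * x j) * (1 - y * inverse (x j)))"

definition numer_term :: "'a::field \<Rightarrow> 'a \<Rightarrow> 'a \<Rightarrow> nat set \<Rightarrow> (nat \<Rightarrow> 'a) \<Rightarrow> 'a \<Rightarrow> 'a" where
  "numer_term t c d I x y =
     (1 - c * y) * (1 - d * y) * (\<Prod>j\<in>I. (1 - t * y * x j) * (1 - y * inverse (x j))) -
     y\<^sup>2 * (y - c) * (y - d) * (\<Prod>j\<in>I. (1 - y * x j) * (t - y * inverse (x j)))"

definition numer :: "'a::field \<Rightarrow> 'a \<Rightarrow> 'a \<Rightarrow> nat set \<Rightarrow> (nat \<Rightarrow> 'a) \<Rightarrow> 'a \<Rightarrow> 'a" where
  "numer t c d I x y =
     (\<Sum>E\<in>Pow I. signed_term t c d I (flip E x) * numer_term t c d I (flip E x) y)"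

lemma denom_flip: "denom I (flip E x) y = denom I x y"
  unfolding denom_def flip_def by (rule prod.cong) auto

lemma numer_term_eq:
  fixes y :: "'a::field"
  assumes "regular_on (insert k I) x" "k \<notin> I" "finite I" "y = x k"
  shows "y * (1 - y\<^sup>2) * denom I x y * 
     (c_factor c d y * (\<Prod>j\<in>I. pair_factor t y (x j)) +
        c_factor c d (inverse y) * (\<Prod>j\<in>I. pair_factor t (inverse y) (x j))) = numer_term t c d I x y"
proof -
  have y: "y \<noteq> 0" "y\<^sup>2 \<noteq> 1" using assms by (auto simp: regular_on_def)
  have yj: "x j \<noteq> 0" "y \<noteq> x j" "y * x j \<noteq> 1" if "j \<in> I" for j
    using that assms by (auto simp: regular_on_def)
  have 1: "denom I x y * (\<Prod>j\<in>I. pair_factor t y (x j)) = (\<Prod>j\<in>I. (1 - t * y * x j) * (1 - y * inverse (x j)))"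
    unfolding denom_def prod.distrib[symmetric]
    by (rule prod.cong) (use yj in \<open>auto simp: pair_factor_def\<close>)
  have 2: "denom I x y * (\<Prod>j\<in>I. pair_factor t (inverse y) (x j)) = (\<Prod>j\<in>I. (1 - y * x j) * (t - y * inverse (x j)))"
    unfolding denom_def prod.distrib[symmetric]
    by (rule prod.cong) (use y yj in \<open>auto simp: pair_factor_inverse\<close>)
  have 3: "K * D * (A * P + B * Q) = K * A * (D * P) - R * (D * Q)" if "K * B = - R"
    for K D A P B Q R :: 'a
    using that by algebra
  show ?thesis
    unfolding numer_term_def 1[symmetric] 2[symmetric] c_factor_mult(1)[OF y, symmetric]
    by (rule 3) (rule c_factor_mult(2)[OF y])
qed

lemma numer_eq_signed_sum:
  assumes "regular_on (insert k I) x" "k \<notin> I" "finite I"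
  shows "numer t c d I x (x k) =
     x k * (1 - (x k)\<^sup>2) * denom I x (x k) * signed_sum t c d (insert k I) x"
  unfolding numer_def signed_sum_insert[OF assms(3,2)] sum_distrib_left
proof (rule sum.cong)
  fix E assume "E \<in> Pow I"
  then have "flip E x k = x k" using assms(2) by (auto simp: flip_def)
  then have "numer_term t c d I (flip E x) (x k) = x k * (1 - (x k)\<^sup>2) * denom I x (x k) * 
     (c_factor c d (x k) * (\<Prod>j\<in>I. pair_factor t (x k) (flip E x j)) +
        c_factor c d (inverse (x k)) * (\<Prod>j\<in>I. pair_factor t (inverse (x k)) (flip E x j)))"
    using numer_term_eq[OF regular_on_flip[OF assms(1), of E] assms(2,3), of "x k" c d t]
    by (simp add: denom_flip)
  then show "signed_term t c d I (flip E x) * numer_term t c d I (flip E x) (x k) =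
     x k * (1 - (x k)\<^sup>2) * denom I x (x k) * (signed_term t c d I (flip E x) *
       (c_factor c d (x k) * (\<Prod>j\<in>I. pair_factor t (x k) (flip E x j)) +
        c_factor c d (inverse (x k)) * (\<Prod>j\<in>I. pair_factor t (inverse (x k)) (flip E x j))))"
    by (simp only: mult_ac)
qed simp

lemma numer_at_0: "numer t c d I x 0 = signed_sum t c d I x"
  by (simp add: numer_def numer_term_def signed_sum_def)

text \<open>At these points \<open>y\<close> and \<open>inverse y\<close> coincide, so the two
  products in \<open>numer_term\<close> agree and the apparent pole from
  \<open>1 - y\<^sup>2\<close> disappears.\<close>

lemma numer_at_1:
  fixes y :: "'a::field"
  assumes "regular_on I x" "y\<^sup>2 = 1"
  shows "numer t c d I x y = 0"
proof -
  have "numer_term t c d I z y = 0" if "regular_on I z" for z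
  proof -
    have "(1 - t * y * z j) * (1 - y * inverse (z j)) = (1 - y * z j) * (t - y * inverse (z j))" if "j \<in> I" for j
    proof -
      have "z j * inverse (z j) = 1" using that \<open>regular_on I z\<close> by (auto simp: regular_on_def)
      then show ?thesis using assms(2) by algebra
    qed
    then have "(\<Prod>j\<in>I. (1 - t * y * z j) * (1 - y * inverse (z j))) = (\<Prod>j\<in>I. (1 - y * z j) * (t - y * inverse (z j)))"
      by (intro prod.cong) auto
    moreover have "(1 - c * y) * (1 - d * y) * P - y\<^sup>2 * (y - c) * (y - d) * P = 0" for P
      using assms(2) by algebra
    ultimately show ?thesis unfolding numer_term_def by simp
  qed
  then show ?thesis unfolding numer_def using regular_on_flip[OF assms(1)] by simp
qed

text \<open>Setting \<open>y = c\<close> trades the factors \<open>1 - c * x j\<close> for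
  \<open>1 - t * c * x j\<close>; this is where the parameter \<open>t * c\<close> comes
  from.\<close>

lemma signed_term_shift:
  assumes "finite I" "regular_on I x"
  shows "signed_term t c d I x * (\<Prod>j\<in>I. (1 - t * c * x j) * (1 - c * inverse (x j))) =
      denom I x c * signed_term t (t * c) d I x"
proof -
  have "(\<Prod>i\<in>I. c_factor c d (x i)) * (\<Prod>j\<in>I. (1 - t * c * x j) * (1 - c * inverse (x j))) =
     denom I x c * (\<Prod>i\<in>I. c_factor (t * c) d (x i))"
    unfolding denom_def prod.distrib[symmetric] c_factor_def by (rule prod.cong) (auto simp: mult_ac)
  then show ?thesis unfolding signed_term_def by (simp add: mult_ac)
qed

lemma numer_at_param:
  fixes c :: "'a::field"
  assumes "finite I" "regular_on I x"
  shows "numer t c d I x c = (1 - c\<^sup>2) * (1 - c * d) * denom I x c * signed_sum t (t * c) d I x"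
  unfolding numer_def signed_sum_def sum_distrib_left
proof (rule sum.cong)
  fix E
  have "numer_term t c d I (flip E x) c = (1 - c\<^sup>2) * (1 - c * d) * (\<Prod>j\<in>I. (1 - t * c * flip E x j) * (1 - c * inverse (flip E x j)))"
    by (simp add: numer_term_def power2_eq_square mult_ac)
  then show "signed_term t c d I (flip E x) * numer_term t c d I (flip E x) c = (1 - c\<^sup>2) * (1 - c * d) * denom I x c * signed_term t (t * c) d I (flip E x)"
    using signed_term_shift[OF assms(1) regular_on_flip[OF assms(2)], of t c d E]
    by (simp add: denom_flip mult_ac)
qed simp

text \<open>This mirrors \<open>y = c\<close>: there the second product of \<open>numer_term\<close>
  dies through \<open>y - c\<close>, here the first through \<open>1 - c * y\<close>. It supplies
  one more interpolation node.\<close>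

lemma numer_at_inverse_param:
  fixes c :: "'a::field"
  assumes "finite I" "regular_on I x" "c \<noteq> 0"
  shows "c * numer t c d I x (inverse c) =
    (1 - (inverse c)\<^sup>2) * denom I x (inverse c) * (inverse c * (1 - c * d) * signed_sum t (t * c) d I x)"
proof -
  \<comment> \<open>Moving from \<open>c\<close> to \<open>inverse c\<close> multiplies
    \<open>denom\<close> by a power that the surviving product of \<open>numer_term\<close> picks up
    too.\<close>
  have den: "denom I x (inverse c) = inverse c ^ (2 * card I) * denom I x c"
    (is "_ = ?q * _")
  proof -
    have "denom I x (inverse c) = (\<Prod>j\<in>I. (inverse c)\<^sup>2 * ((1 - c * x j) * (1 - c * inverse (x j))))"
      unfolding denom_def
    proof (rule prod.cong)
      fix j assume "j \<in> I"
      then have "x j * inverse (x j) = 1" "c * inverse c = 1" using assms by (auto simp: regular_on_def)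
      then show "(1 - inverse c * x j) * (1 - inverse c * inverse (x j)) =
          (inverse c)\<^sup>2 * ((1 - c * x j) * (1 - c * inverse (x j)))" by algebra
    qed simp
    then show ?thesis unfolding prod.distrib denom_def by (simp add: power_mult)
  qed
  have num: "c * numer_term t c d I z (inverse c) = (1 - (inverse c)\<^sup>2) * ?q * (inverse c * (1 - c * d)) *
     (\<Prod>j\<in>I. (1 - t * c * z j) * (1 - c * inverse (z j)))"
    if "regular_on I z" for z
  proof -
    have "(\<Prod>j\<in>I. (1 - inverse c * z j) * (t - inverse c * inverse (z j))) =
        (\<Prod>j\<in>I. (inverse c)\<^sup>2 * ((1 - t * c * z j) * (1 - c * inverse (z j))))"
    proof (rule prod.cong)
      fix j assume "j \<in> I"
      then have "z j * inverse (z j) = 1" "c * inverse c = 1" using assms that by (auto simp: regular_on_def)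
      then show "(1 - inverse c * z j) * (t - inverse c * inverse (z j)) =
        (inverse c)\<^sup>2 * ((1 - t * c * z j) * (1 - c * inverse (z j)))" by algebra
    qed simp
    then have e: "(\<Prod>j\<in>I. (1 - inverse c * z j) * (t - inverse c * inverse (z j))) =
       ?q * (\<Prod>j\<in>I. (1 - t * c * z j) * (1 - c * inverse (z j)))"
      unfolding prod.distrib by (simp add: power_mult)
    have "c * ((1 - c * i) * (1 - d * i) * P - i\<^sup>2 * (i - c) * (i - d) * (R * Q)) =
        (1 - i\<^sup>2) * R * (i * (1 - c * d)) * Q" if "c * i = 1" for i P Q R
      using that by algebra
    from this[of "inverse c"] show ?thesis unfolding numer_term_def e using assms(3) by simp
  qed
  show ?thesis
    unfolding numer_def signed_sum_def sum_distrib_left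
  proof (rule sum.cong)
    fix E
    let ?P = "\<Prod>j\<in>I. (1 - t * c * flip E x j) * (1 - c * inverse (flip E x j))"
    have "c * (signed_term t c d I (flip E x) * numer_term t c d I (flip E x) (inverse c)) =
       (1 - (inverse c)\<^sup>2) * ?q * (inverse c * (1 - c * d)) * (signed_term t c d I (flip E x) * ?P)"
      unfolding mult.left_commute[of c] num[OF regular_on_flip[OF assms(2), of E]] by (simp only: mult_ac)
    also have "signed_term t c d I (flip E x) * ?P = denom I x c * signed_term t (t * c) d I (flip E x)"
      using signed_term_shift[OF assms(1) regular_on_flip[OF assms(2)], of t c d E] by (simp add: denom_flip)
    finally show "c * (signed_term t c d I (flip E x) * numer_term t c d I (flip E x) (inverse c)) =
      (1 - (inverse c)\<^sup>2) * denom I x (inverse c) * (inverse c * (1 - c * d) * signed_term t (t * c) d I (flip E x))"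
      unfolding den by (simp only: mult_ac)
  qed simp
qed

lemma numer_term_insert:
  assumes "finite I" "k \<notin> I"
  shows "numer_term t c d (insert k I) x y =
     (1 - c * y) * (1 - d * y) * ((1 - t * y * x k) * (1 - y * inverse (x k))) *
        (\<Prod>j\<in>I. (1 - t * y * x j) * (1 - y * inverse (x j))) -
     y\<^sup>2 * (y - c) * (y - d) * ((1 - y * x k) * (t - y * inverse (x k))) *
        (\<Prod>j\<in>I. (1 - y * x j) * (t - y * inverse (x j)))"
  using assms unfolding numer_term_def by (simp add: mult_ac)

text \<open>The residues at \<open>y = a\<close> and \<open>y = 1/a\<close> of the two terms that differ by inverting the
  variable \<open>a\<close> cancel.\<close>

lemma numer_terms_cancel:
  fixes a :: "'a::field"
  assumes "regular_on I x" "a \<noteq> 0" "a\<^sup>2 \<noteq> 1" "\<And>j. j \<in> I \<Longrightarrow> a \<noteq> x j \<and> a * x j \<noteq> 1"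
  shows "c_factor c d a * (\<Prod>j\<in>I. pair_factor t a (x j)) *
      (- (a\<^sup>2 * (a - c) * (a - d) * ((1 - a * a) * (t - 1)) * (\<Prod>j\<in>I. (1 - a * x j) * (t - a * inverse (x j))))) +
     c_factor c d (inverse a) * (\<Prod>j\<in>I. pair_factor t (inverse a) (x j)) *
      ((1 - c * a) * (1 - d * a) * ((1 - t) * (1 - a * a)) * (\<Prod>j\<in>I. (1 - t * a * x j) * (1 - a * inverse (x j)))) = 0"
proof -
  have 1: "(\<Prod>j\<in>I. pair_factor t a (x j)) * (\<Prod>j\<in>I. (1 - a * x j) * (t - a * inverse (x j))) =
     (\<Prod>j\<in>I. (1 - t * a * x j) * (t - a * inverse (x j)))"
    unfolding prod.distrib[symmetric] pair_factor_def
    by (rule prod.cong) (use assms(4) in \<open>auto simp: divide_simps\<close>)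
  have 2: "(\<Prod>j\<in>I. pair_factor t (inverse a) (x j)) * (\<Prod>j\<in>I. (1 - t * a * x j) * (1 - a * inverse (x j))) =
     (\<Prod>j\<in>I. (1 - t * a * x j) * (t - a * inverse (x j)))"
    unfolding prod.distrib[symmetric]
  proof (rule prod.cong)
    fix j assume j: "j \<in> I"
    then have xj: "x j \<noteq> 0" "a \<noteq> x j" using assms by (auto simp: regular_on_def)
    have "p * (q * r) = q * s" if "r * p = s" for p q r s :: 'a
      by (simp add: that[symmetric] mult_ac)
    from this[OF pair_factor_inverse[OF assms(2) xj]]
    show "pair_factor t (inverse a) (x j) * ((1 - t * a * x j) * (1 - a * inverse (x j))) = (1 - t * a * x j) * (t - a * inverse (x j))" .
  qed simp
  note 3 = c_factor_mult(1)[OF assms(2,3), of c d] and 4 = c_factor_mult(2)[OF assms(2,3), of c d]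
  have nz: "a * (1 - a\<^sup>2) \<noteq> 0" using assms by simp
  \<comment> \<open>By \<open>1\<close> and \<open>2\<close> both products over \<open>I\<close>
    reduce to the same \<open>R\<close>. Only one-variable factors remain, and clearing them by
    \<open>a * (1 - a\<^sup>2)\<close> exhibits the cancellation.\<close>
  have *: "A * P * (- (a\<^sup>2 * (a - c) * (a - d) * ((1 - a * a) * (t - 1)) * P')) +
      B * Q * ((1 - c * a) * (1 - d * a) * ((1 - t) * (1 - a * a)) * Q') = 0"
    if "P * P' = R" "Q * Q' = R" "a * (1 - a\<^sup>2) * A = (1 - c * a) * (1 - d * a)"
      "a * (1 - a\<^sup>2) * B = - (a\<^sup>2 * (a - c) * (a - d))"
    for A B P P' Q Q' R
  proof -
    have "K * (A * P * (- (V * (w * (t - 1)) * P')) + B * Q * (U * ((1 - t) * w) * Q')) =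
        (1 - t) * w * ((K * A) * V * (P * P') + (K * B) * U * (Q * Q'))" for K V w U :: 'a
      by (simp add: algebra_simps)
    then have "a * (1 - a\<^sup>2) * (A * P * (- (a\<^sup>2 * (a - c) * (a - d) * ((1 - a * a) * (t - 1)) * P')) +
      B * Q * ((1 - c * a) * (1 - d * a) * ((1 - t) * (1 - a * a)) * Q')) = 0"
      by (simp only: that) simp
    then show ?thesis using nz by (simp only: mult_eq_0_iff) simp
  qed
  show ?thesis by (rule *[OF 1 2 3 4])
qed

text \<open>The poles at these points are spurious: the subsets \<open>E\<close> and
  \<open>insert k E\<close> are paired, and their contributions cancel.\<close>

lemma numer_at_variable:
  assumes "finite I" "regular_on I x" "k \<in> I" "y = x k \<or> y = inverse (x k)"
  shows "numer t c d I x y = 0"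
proof -
  define J where "J = I - {k}"
  have J: "finite J" "k \<notin> J" "I = insert k J" using assms by (auto simp: J_def)
  have xk: "x k \<noteq> 0" "(x k)\<^sup>2 \<noteq> 1" using assms by (auto simp: regular_on_def)
  show ?thesis
    unfolding J(3) numer_def sum_Pow_insert[OF J(1,2)]
  proof (rule sum.neutral, rule ballI)
    fix E assume "E \<in> Pow J"
    then have E: "E \<subseteq> J" by simp
    define z where "z = flip E x"
    have zk: "z k = x k" using flip_fresh(1)[OF E J(2)] by (simp add: z_def)
    have reg: "regular_on I z" unfolding z_def by (rule regular_on_flip[OF assms(2)])
    have regJ: "regular_on J z" by (rule regular_on_subset[OF reg]) (auto simp: J(3))
    have nek: "x k \<noteq> z j \<and> x k * z j \<noteq> 1" if "j \<in> J" for j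
      using reg that J(2) unfolding regular_on_def J(3) zk[symmetric] by auto
    have zJ: "flip (insert k E) x j = z j" if "j \<in> J" for j
      using that J(2) by (subst flip_fresh(3)) (auto simp: z_def)
    have "z j \<noteq> 0" if "j \<in> J" for j using that regJ by (auto simp: regular_on_def)
    then have nek': "inverse (x k) \<noteq> z j \<and> inverse (x k) * z j \<noteq> 1" if "j \<in> J" for j
      using nek[OF that] that xk by (simp add: inverse_mult_eq_1)
    let ?T = "signed_term t c d J z"
    have T: "signed_term t c d (insert k J) z = c_factor c d (x k) * (\<Prod>j\<in>J. pair_factor t (x k) (z j)) * ?T"
      "signed_term t c d (insert k J) (flip (insert k E) x) =
        c_factor c d (inverse (x k)) * (\<Prod>j\<in>J. pair_factor t (inverse (x k)) (z j)) * ?T"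
      unfolding z_def by (rule signed_term_flip_insert[OF J(1,2) E])+
    have N0: "numer_term t c d (insert k J) z y =
     (1 - c * y) * (1 - d * y) * ((1 - t * y * x k) * (1 - y * inverse (x k))) *
        (\<Prod>j\<in>J. (1 - t * y * z j) * (1 - y * inverse (z j))) -
     y\<^sup>2 * (y - c) * (y - d) * ((1 - y * x k) * (t - y * inverse (x k))) *
        (\<Prod>j\<in>J. (1 - y * z j) * (t - y * inverse (z j)))"
      unfolding numer_term_insert[OF J(1,2)] zk ..
    have N: "numer_term t c d (insert k J) (flip (insert k E) x) y =
     (1 - c * y) * (1 - d * y) * ((1 - t * y * inverse (x k)) * (1 - y * x k)) *
        (\<Prod>j\<in>J. (1 - t * y * z j) * (1 - y * inverse (z j))) -
     y\<^sup>2 * (y - c) * (y - d) * ((1 - y * inverse (x k)) * (t - y * x k)) *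
        (\<Prod>j\<in>J. (1 - y * z j) * (t - y * inverse (z j)))"
      unfolding numer_term_insert[OF J(1,2)] by (simp add: zJ flip_fresh(2) cong: prod.cong)
    have sq: "(inverse (x k))\<^sup>2 \<noteq> 1" "inverse (x k) \<noteq> 0" using xk by (auto simp: power_inverse)
    show "signed_term t c d (insert k J) (flip E x) * numer_term t c d (insert k J) (flip E x) y +
       signed_term t c d (insert k J) (flip (insert k E) x) * numer_term t c d (insert k J) (flip (insert k E) x) y = 0"
      using assms(4)
    proof
      assume y: "y = x k"
      have "A * T * (X * ((1 - t * a * a) * (1 - a * i)) * P - Z * ((1 - a * a) * (t - a * i)) * P') +
          B * T * (X * ((1 - t * a * i) * (1 - a * a)) * Q - Z * ((1 - a * i) * (t - a * a)) * Q') = 0"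
        if "A * (- (Z * ((1 - a * a) * (t - 1)) * P')) + B * (X * ((1 - t) * (1 - a * a)) * Q) = 0" "a * i = 1"
        for A B T X Z P P' Q Q' a i :: 'a
        using that by algebra
      note * = this
      show ?thesis
        unfolding z_def[symmetric] T N N0 unfolding y
        by (rule *[OF numer_terms_cancel[OF regJ xk nek]]) (use xk in auto)
    next
      \<comment> \<open>The same cancellation with \<open>a = inverse (x k)\<close>, the paired
        subsets exchanging roles.\<close>
      assume y: "y = inverse (x k)"
      have "B * T * (X * ((1 - t * i * a) * (1 - i * i)) * Q - Z * ((1 - i * a) * (t - i * i)) * Q') +
          A * T * (X * ((1 - t * i * i) * (1 - i * a)) * P - Z * ((1 - i * i) * (t - i * a)) * P') = 0"
        if "A * (- (Z * ((1 - i * i) * (t - 1)) * P')) + B * (X * ((1 - t) * (1 - i * i)) * Q) = 0" "i * a = 1"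
        for A B T X Z P P' Q Q' a i :: 'a
        using that by algebra
      note * = this
      show ?thesis
        unfolding z_def[symmetric] T N N0 unfolding y
        by (rule *[OF numer_terms_cancel[OF regJ sq(2,1) nek', unfolded inverse_inverse_eq]]) (use xk in auto)
    qed
  qed
qed

lemma poly_fun_numer:
  assumes "finite I"
  shows "poly_fun (2 * card I + 4) (numer t c d I x)"
proof -
  have lin: "poly_fun (Suc 0) (\<lambda>y. 1 - a * y)" "poly_fun (Suc 0) (\<lambda>y. a - y * b)"
    "poly_fun (Suc 0) (\<lambda>y. y - a)" "poly_fun (Suc 0) (\<lambda>y. 1 - a * y * b)" for a b :: 'a
    using poly_fun_linear[of 1 "-a"] poly_fun_linear[of a "-b"] poly_fun_linear[of "-a" 1]
      poly_fun_linear[of 1 "- (a * b)"]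
    by (simp_all add: algebra_simps)
  have deg_term: "poly_fun (2 * card I + 4) (numer_term t c d I z)" for z
  proof -
    have "poly_fun 2 (\<lambda>y. (1 - t * y * z j) * (1 - y * inverse (z j)))"
      "poly_fun 2 (\<lambda>y. (1 - y * z j) * (t - y * inverse (z j)))" for j
      using poly_fun_mult[OF lin(4) lin(2), of t "z j" 1 "inverse (z j)"]
        poly_fun_mult[OF lin(2) lin(2), of 1 "z j" t "inverse (z j)"]
      by (simp_all add: numeral_2_eq_2)
    then have P: "poly_fun (2 * card I) (\<lambda>y. \<Prod>j\<in>I. (1 - t * y * z j) * (1 - y * inverse (z j)))"
      "poly_fun (2 * card I) (\<lambda>y. \<Prod>j\<in>I. (1 - y * z j) * (t - y * inverse (z j)))"
      by (auto intro: poly_fun_prod)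
    have "poly_fun (2 * card I + 4) (\<lambda>y. (1 - c * y) * (1 - d * y) * (\<Prod>j\<in>I. (1 - t * y * z j) * (1 - y * inverse (z j))))"
      by (rule poly_fun_mono[OF poly_fun_mult[OF poly_fun_mult[OF lin(1) lin(1)] P(1)]]) simp
    moreover have "poly_fun (2 * card I + 4) (\<lambda>y. y\<^sup>2 * (y - c) * (y - d) * (\<Prod>j\<in>I. (1 - y * z j) * (t - y * inverse (z j))))"
      by (rule poly_fun_mono[OF poly_fun_mult[OF poly_fun_mult[OF poly_fun_mult[OF poly_fun_power lin(3)] lin(3)] P(2)]]) simp
    ultimately show ?thesis
      unfolding numer_term_def[abs_def] by (rule poly_fun_diff)
  qed
  show ?thesis
    unfolding numer_def[abs_def] by (intro poly_fun_sum poly_fun_cmult deg_term)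
qed

text \<open>Both sides have degree at most \<open>2 * card I + 4\<close> and agree at
  \<open>2 * card I + 5\<close> points. The quadratic is \<open>(y - c) * (c * y - 1)\<close>, so
  \<open>y = 0\<close> fixes the coefficient of the first signed sum and \<open>y = c\<close> that
  of the second.\<close>

lemma numer_eq:
  fixes c :: "'a::field_char_0"
  assumes fin: "finite I" and reg: "regular_on I x" and c: "c \<noteq> 0" "c\<^sup>2 \<noteq> 1"
    and cx: "\<And>j. j \<in> I \<Longrightarrow> c \<noteq> x j \<and> c * x j \<noteq> 1"
  shows "c * numer t c d I x y = (1 - y\<^sup>2) * denom I x y *
     ((c * (y\<^sup>2 + 1) - (1 + c\<^sup>2) * y) * signed_sum t c d I x +
      y * (1 - c * d) * signed_sum t (t * c) d I x)" (is "_ = ?R y")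
proof -
  \<comment> \<open>The conditions on \<open>c\<close> and \<open>x\<close>, together with 1
    \<noteq> -1 in characteristic zero, keep these nodes distinct.\<close>
  let ?S = "{0, 1, - 1, c, inverse c} \<union> (x ` I \<union> (\<lambda>j. inverse (x j)) ` I)"
  have inj: "inj_on x I" "inj_on (\<lambda>j. inverse (x j)) I"
    using reg by (auto simp: inj_on_def regular_on_def)
  have xj: "x j \<noteq> 0" "(x j)\<^sup>2 \<noteq> 1" "x j \<noteq> 1" "x j \<noteq> - 1" if "j \<in> I" for j
    using reg that by (auto simp: regular_on_def)
  have xij: "x i * x j \<noteq> 1" if "i \<in> I" "j \<in> I" for i j
    using reg that by (cases "i = j") (auto simp: regular_on_def power2_eq_square)
  have card1: "card (x ` I \<union> (\<lambda>j. inverse (x j)) ` I) = 2 * card I"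
  proof -
    have "x ` I \<inter> (\<lambda>j. inverse (x j)) ` I = {}"
      using xj(1) xij by (auto simp: inverse_mult_eq_1)
    then show ?thesis using fin inj by (simp add: card_Un_disjoint card_image)
  qed
  have c': "c \<noteq> 1" "c \<noteq> - 1" "c \<noteq> inverse c" "inverse c \<noteq> 1" "inverse c \<noteq> - 1" 
  proof -
    show "c \<noteq> 1" "c \<noteq> - 1" using c(2) by auto
    then show "inverse c \<noteq> 1" "inverse c \<noteq> - 1"
      by (simp, metis inverse_inverse_eq inverse_minus_eq inverse_1)
    show "c \<noteq> inverse c" using c by (simp add: inverse_mult_eq_1 power2_eq_square)
  qed
  have "{0, 1, - 1, c, inverse c} \<inter> (x ` I \<union> (\<lambda>j. inverse (x j)) ` I) = {}"
  proof -
    have new: "x j \<notin> {0, 1, - 1, c, inverse c} \<and> inverse (x j) \<notin> {0, 1, - 1, c, inverse c}" if "j \<in> I" for j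
    proof -
      have "inverse (x j) \<noteq> 1" "inverse (x j) \<noteq> - 1"
        using xj(3,4)[OF that] by (simp, metis inverse_inverse_eq inverse_minus_eq inverse_1)
      moreover have "x j \<noteq> inverse c" "inverse (x j) \<noteq> c"
        using cx[OF that] c xj[OF that] by (auto simp: inverse_mult_eq_1 mult.commute)
      ultimately show ?thesis using xj[OF that] cx[OF that] by auto
    qed
    have disj: "(\<And>j. j \<in> I \<Longrightarrow> x j \<notin> Z \<and> g j \<notin> Z) \<Longrightarrow> Z \<inter> (x ` I \<union> g ` I) = {}" for Z g
      by blast
    show ?thesis by (rule disj) (rule new)
  qed
  moreover have "card {0, 1, - 1, c, inverse c} = 5"
  proof -
    have "(0::'a) \<notin> {1, - 1, c, inverse c}" "(1::'a) \<notin> {- 1, c, inverse c}" "- 1 \<notin> {c, inverse c}" "c \<notin> {inverse c}"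
      using c c' by auto
    then show ?thesis by simp
  qed
  ultimately have card: "card ?S = 2 * card I + 5"
    using fin card1 by (subst card_Un_disjoint) auto
  have lin: "poly_fun (Suc 0) (\<lambda>y. 1 - y * b)" for b :: 'a
    using poly_fun_linear[of 1 "-b"] by (simp add: algebra_simps)
  have quad: "poly_fun 2 (\<lambda>y. 1 - y\<^sup>2 :: 'a)" "poly_fun 2 (\<lambda>y. c * (y\<^sup>2 + 1) - (1 + c\<^sup>2) * y)"
    "poly_fun 2 (\<lambda>y. y * b)" for b :: 'a
  proof -
    have id2: "poly_fun 2 (\<lambda>y. y :: 'a)" and c2: "poly_fun 2 (\<lambda>y. a :: 'a)" for a
      by (rule poly_fun_mono[OF poly_fun_id] poly_fun_mono[OF poly_fun_const], simp)+
    show "poly_fun 2 (\<lambda>y. 1 - y\<^sup>2 :: 'a)"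
      by (intro poly_fun_diff c2 poly_fun_power)
    show "poly_fun 2 (\<lambda>y. c * (y\<^sup>2 + 1) - (1 + c\<^sup>2) * y)"
      by (intro poly_fun_diff poly_fun_cmult poly_fun_add c2 id2 poly_fun_power)
    show "poly_fun 2 (\<lambda>y. y * b)"
      using poly_fun_cmult[OF id2, of b] by (simp add: mult.commute)
  qed
  have "poly_fun (2 * card I) (denom I x)"
  proof -
    have "poly_fun 2 (\<lambda>y. (1 - y * x j) * (1 - y * inverse (x j)))" for j
      using poly_fun_mult[OF lin lin, of "x j" "inverse (x j)"] by (simp add: numeral_2_eq_2)
    then show ?thesis unfolding denom_def[abs_def] by (rule poly_fun_prod)
  qed
  then have "poly_fun (2 + 2 * card I + 2) ?R"
    by (intro poly_fun_mult poly_fun_add quad)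
       (use poly_fun_mult[OF quad(2) poly_fun_const] poly_fun_mult[OF quad(3) poly_fun_const, of _ 1]
          quad(3)[of "(1 - c * d) * signed_sum t (t * c) d I x"] in \<open>simp_all add: mult.assoc\<close>)
  then have R: "poly_fun (2 * card I + 4) ?R"
    by (rule poly_fun_mono) simp
  have "c * numer t c d I x y - ?R y = 0"
  proof (rule poly_fun_eq_0[of "2 * card I + 4" "\<lambda>y. c * numer t c d I x y - ?R y" ?S])
    show "poly_fun (2 * card I + 4) (\<lambda>y. c * numer t c d I x y - ?R y)"
      by (intro poly_fun_diff poly_fun_cmult poly_fun_numer[OF fin] R)
    show "2 * card I + 4 < card ?S" using card by simp
    have den: "denom I x y = 0" if "j \<in> I" "y = x j \<or> y = inverse (x j)" for j y
      unfolding denom_def prod_zero_iff[OF fin] using that xj[OF that(1)] by (intro bexI[of _ j]) auto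
    fix y assume "y \<in> ?S"
    then consider "y = 0" | "y\<^sup>2 = 1" | "y = c" | "y = inverse c" | j where "j \<in> I" "y = x j \<or> y = inverse (x j)"
      by auto
    then show "c * numer t c d I x y - ?R y = 0"
    proof cases
      case 1
      then show ?thesis by (simp add: numer_at_0 denom_def)
    next
      case 2
      then show ?thesis by (simp add: numer_at_1[OF reg])
    next
      case 3
      have e: "c * (c\<^sup>2 + 1) - (1 + c\<^sup>2) * c = 0" by (simp add: algebra_simps)
      show ?thesis unfolding 3 e numer_at_param[OF fin reg] by (simp add: mult_ac)
    next
      case 4
      have "c * inverse c = 1" using c by simp
      then have e: "c * ((inverse c)\<^sup>2 + 1) - (1 + c\<^sup>2) * inverse c = 0" by algebra
      show ?thesis unfolding 4 e numer_at_inverse_param[OF fin reg c(1)] by simp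
    next
      case 5
      then show ?thesis using numer_at_variable[OF fin reg 5] den[OF 5] by simp
    qed
  qed
  then show ?thesis by simp
qed

text \<open>At \<open>y = x k\<close> the common nonzero factor in \<open>numer_eq\<close> cancels,
  leaving an affine function of \<open>x k + inverse (x k)\<close>.\<close>

lemma signed_sum_recursion:
  fixes c :: "'a::field_char_0"
  assumes "finite I" "k \<notin> I" "regular_on (insert k I) x" "c \<noteq> 0" "c\<^sup>2 \<noteq> 1"
    and "\<And>j. j \<in> I \<Longrightarrow> c \<noteq> x j \<and> c * x j \<noteq> 1"
  shows "c * signed_sum t c d (insert k I) x =
     (c * (x k + inverse (x k)) - (1 + c\<^sup>2)) * signed_sum t c d I x +
     (1 - c * d) * signed_sum t (t * c) d I x"
proof -
  let ?y = "x k"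
  have reg: "regular_on I x" using assms(3) by (rule regular_on_subset) auto
  have y: "?y \<noteq> 0" "?y\<^sup>2 \<noteq> 1" using assms(3) by (auto simp: regular_on_def)
  have "denom I x ?y \<noteq> 0"
    unfolding denom_def prod_zero_iff[OF assms(1)]
    using assms(2,3) by (auto simp: regular_on_def inverse_mult_eq_1)
  then have nz: "?y * ((1 - ?y\<^sup>2) * denom I x ?y) \<noteq> 0" using y by simp
  have "?y * inverse ?y = 1" using y by simp
  then have e: "(c * (?y\<^sup>2 + 1) - (1 + c\<^sup>2) * ?y) = ?y * (c * (?y + inverse ?y) - (1 + c\<^sup>2))" by algebra
  have "?y * ((1 - ?y\<^sup>2) * denom I x ?y) * (c * signed_sum t c d (insert k I) x) = c * numer t c d I x ?y"
    unfolding numer_eq_signed_sum[OF assms(3,2,1)] by (simp only: mult_ac)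
  also have "\<dots> = ?y * ((1 - ?y\<^sup>2) * denom I x ?y) * ((c * (?y + inverse ?y) - (1 + c\<^sup>2)) * signed_sum t c d I x +
     (1 - c * d) * signed_sum t (t * c) d I x)"
  proof -
    have "c * numer t c d I x ?y = (1 - ?y\<^sup>2) * denom I x ?y *
      ((c * (?y\<^sup>2 + 1) - (1 + c\<^sup>2) * ?y) * signed_sum t c d I x +
       ?y * (1 - c * d) * signed_sum t (t * c) d I x)"
      by (rule numer_eq[OF assms(1) reg assms(4,5)]) (rule assms(6))
    then show ?thesis unfolding e by (simp only: algebra_simps)
  qed
  finally show ?thesis using nz by (simp only: mult_cancel_left) blast
qed

lemma poly_fun_signed_sum:
  assumes "finite I"
  shows "poly_fun (card I) (\<lambda>c. signed_sum t c d I x)"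
proof -
  have "poly_fun (Suc 0) (\<lambda>c. c_factor c d y)" for y
  proof -
    have "(\<lambda>c. c_factor c d y) = (\<lambda>c. (1 + (- y) * c) * ((1 - d * y) / (y * (1 - y\<^sup>2))))"
      by (simp add: c_factor_def fun_eq_iff mult.commute)
    then show ?thesis
      using poly_fun_mult[OF poly_fun_linear[of 1 "- y"] poly_fun_const[of "(1 - d * y) / (y * (1 - y\<^sup>2))"]] by simp
  qed
  then have "poly_fun (card I) (\<lambda>c. \<Prod>i\<in>I. c_factor c d (z i))" for z
    using poly_fun_prod[of I "Suc 0" "\<lambda>i c. c_factor c d (z i)"] by simp
  from poly_fun_mult[OF this poly_fun_const] have "poly_fun (card I) (\<lambda>c. signed_term t c d I z)" for z
    unfolding signed_term_def by simp
  then show ?thesis unfolding signed_sum_def by (intro poly_fun_sum)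
qed

subsection \<open>Moments of Al-Salam--Chihara polynomials\<close>

text \<open>Let \<open>L\<close> be the orthogonality functional of the monic polynomials \<open>p\<^sub>k(v)\<close> with
  \<open>v p\<^sub>k = p\<^bsub>k+1\<^esub> + (c + d) t\<^sup>k p\<^sub>k + (1 - t\<^sup>k)(1 - c d t\<^bsup>k-1\<^esup>) p\<^bsub>k-1\<^esub>\<close>.  Then \<open>asc_moment\<close> is
  \<open>L(p\<^sub>k(v) \<Prod>\<^sub>i (x\<^sub>i + 1/x\<^sub>i - v))\<close>.  At \<open>k = 0\<close> the factor \<open>1 - t\<^sup>k\<close> kills the
  truncated index \<open>k - 1\<close>.\<close>

definition jacobi :: "'a::field \<Rightarrow> 'a \<Rightarrow> 'a \<Rightarrow> (nat \<Rightarrow> 'a) \<Rightarrow> nat \<Rightarrow> 'a" where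
  "jacobi t c d w k = w (Suc k) + (c + d) * t ^ k * w k +
     (1 - t ^ k) * (1 - c * d * t ^ (k - 1)) * w (k - 1)"

primrec asc_moment :: "'a::field \<Rightarrow> 'a \<Rightarrow> 'a \<Rightarrow> (nat \<Rightarrow> 'a) \<Rightarrow> nat \<Rightarrow> nat \<Rightarrow> 'a" where
  "asc_moment t c d x 0 k = (if k = 0 then 1 else 0)"
| "asc_moment t c d x (Suc n) k =
     (x (Suc n) + inverse (x (Suc n))) * asc_moment t c d x n k -
     jacobi t c d (asc_moment t c d x n) k"

text \<open>On the level of functionals: \<open>L\<^bsub>c,d\<^esub>((1 + c\<^sup>2 - c v) g) = (1 - c d) L\<^bsub>tc,d\<^esub>(g)\<close>.\<close>

lemma jacobi_intertwine:
  fixes c t :: "'a::field"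
  defines "S \<equiv> \<lambda>d w k. (1 - c * d * t ^ k) * w k - c * w (Suc k)"
  shows "S d (jacobi t c d w) k = jacobi t (t * c) d (S d w) k"
proof (cases k)
  case 0
  then show ?thesis unfolding S_def jacobi_def by (simp add: algebra_simps)
next
  case (Suc m)
  then show ?thesis unfolding S_def jacobi_def by (simp add: algebra_simps)
qed

text \<open>The intertwining relation is carried through the definition one variable at a time.
  Keeping \<open>1 - c * d\<close> on the left lets the relation cover
  \<open>c * d = 1\<close>.\<close>

lemma asc_moment_shift:
  "(1 - c * d) * asc_moment t (t * c) d x n k =
     (1 - c * d * t ^ k) * asc_moment t c d x n k - c * asc_moment t c d x n (Suc k)"
proof (induction n arbitrary: k)
  case 0
  then show ?case by simp
next
  case (Suc n)
  let ?u = "x (Suc n) + inverse (x (Suc n))"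
  let ?S = "\<lambda>w k. (1 - c * d * t ^ k) * w k - c * w (Suc k)"
  have J: "(1 - c * d) * jacobi t (t * c) d w k = jacobi t (t * c) d (\<lambda>k. (1 - c * d) * w k) k" for w
    unfolding jacobi_def by (simp add: algebra_simps)
  have "(1 - c * d) * asc_moment t (t * c) d x (Suc n) k =
     ?u * ((1 - c * d) * asc_moment t (t * c) d x n k) -
     jacobi t (t * c) d (\<lambda>k. (1 - c * d) * asc_moment t (t * c) d x n k) k"
    unfolding J[symmetric] by (simp add: algebra_simps)
  also have "\<dots> = ?u * ?S (asc_moment t c d x n) k - ?S (jacobi t c d (asc_moment t c d x n)) k"
    unfolding Suc.IH jacobi_intertwine ..
  also have "\<dots> = ?S (asc_moment t c d x (Suc n)) k"
    by (simp add: algebra_simps)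
  finally show ?case .
qed

text \<open>The shift at index 0 eliminates the moment at index 1, which gives the recursion of
  \<open>signed_sum_recursion\<close>.\<close>

lemma asc_moment_recursion:
  "c * asc_moment t c d x (Suc n) 0 =
     (c * (x (Suc n) + inverse (x (Suc n))) - (1 + c\<^sup>2)) * asc_moment t c d x n 0 +
     (1 - c * d) * asc_moment t (t * c) d x n 0"
  unfolding asc_moment_shift by (simp add: jacobi_def power2_eq_square algebra_simps)

lemma poly_fun_asc_moment: "poly_fun n (\<lambda>c. asc_moment t c d x n k)"
proof (induction n arbitrary: k)
  case 0
  then show ?case by (simp add: poly_fun_const)
next
  case (Suc n)
  let ?w = "\<lambda>c. asc_moment t c d x n"
  have lin: "poly_fun (Suc 0) (\<lambda>c. (c + d) * t ^ k)"
    "poly_fun (Suc 0) (\<lambda>c. (1 - t ^ k) * (1 - c * d * t ^ (k - 1)))"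
    using poly_fun_linear[of "d * t ^ k" "t ^ k"]
      poly_fun_linear[of "1 - t ^ k" "- (1 - t ^ k) * d * t ^ (k - 1)"]
    by (simp_all add: algebra_simps)
  have "poly_fun (Suc n) (\<lambda>c. jacobi t c d (?w c) k)"
    unfolding jacobi_def
    by (intro poly_fun_add poly_fun_mono[OF Suc.IH]
          poly_fun_mult[OF lin(1) Suc.IH, unfolded plus_nat.add_Suc plus_nat.add_0]
          poly_fun_mult[OF lin(2) Suc.IH, unfolded plus_nat.add_Suc plus_nat.add_0]) auto
  then show ?case
    unfolding asc_moment.simps
    by (intro poly_fun_diff poly_fun_cmult poly_fun_mono[OF Suc.IH]) auto
qed

text \<open>Induction on \<open>n\<close> for all \<open>c\<close> at once, since the recursion
  calls \<open>t * c\<close>. The recursion is available only for \<open>c\<close> outside a finite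
  set; both sides are polynomial in \<open>c\<close>, so equality extends, in particular to
  \<open>c = 0\<close>.\<close>

lemma signed_sum_eq_asc_moment:
  fixes c :: "'a::field_char_0"
  assumes "regular_on {1..n} x"
  shows "signed_sum t c d {1..n} x = asc_moment t c d x n 0"
  using assms
proof (induction n arbitrary: c)
  case 0
  then show ?case by (simp add: signed_sum_def signed_term_def)
next
  case (Suc n)
  have S: "{1..Suc n} = insert (Suc n) {1..n}" by auto
  have reg: "regular_on {1..n} x"
    using Suc.prems by (rule regular_on_subset) auto
  let ?B = "{0, 1, - 1} \<union> x ` {1..n} \<union> (\<lambda>j. inverse (x j)) ` {1..n}"
  show ?case
  proof (rule poly_fun_eq_generic[of _ "\<lambda>c. signed_sum t c d {1..Suc n} x" _
        "\<lambda>c. asc_moment t c d x (Suc n) 0" ?B])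
    show "poly_fun (card {1..Suc n}) (\<lambda>c. signed_sum t c d {1..Suc n} x)"
      by (rule poly_fun_signed_sum) simp
    show "poly_fun (Suc n) (\<lambda>c. asc_moment t c d x (Suc n) 0)"
      by (rule poly_fun_asc_moment)
    show "finite ?B" by simp
    fix c assume c: "c \<notin> ?B"
    have cx: "c \<noteq> x j \<and> c * x j \<noteq> 1" if "j \<in> {1..n}" for j
    proof -
      have "x j \<noteq> 0" using reg that by (auto simp: regular_on_def)
      moreover have "c \<noteq> x j" "c \<noteq> inverse (x j)" "c \<noteq> 0" using c that by auto
      ultimately show ?thesis by (simp add: inverse_mult_eq_1)
    qed
    have "c\<^sup>2 \<noteq> 1" using c by (simp add: power2_eq_1_iff)
    then have "c * signed_sum t c d {1..Suc n} x =
       (c * (x (Suc n) + inverse (x (Suc n))) - (1 + c\<^sup>2)) * signed_sum t c d {1..n} x +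
         (1 - c * d) * signed_sum t (t * c) d {1..n} x"
      using signed_sum_recursion[of "{1..n}" "Suc n" x c t d] Suc.prems c cx unfolding S by auto
    also have "\<dots> = c * asc_moment t c d x (Suc n) 0"
      unfolding asc_moment_recursion using Suc.IH[OF reg] by simp
    finally show "signed_sum t c d {1..Suc n} x = asc_moment t c d x (Suc n) 0"
      using c by simp
  qed
qed

subsection \<open>The theta functional for \<open>c = d = 0\<close>\<close>

lemma esym_insert:
  assumes "finite I" "i \<notin> I"
  shows "esym (insert i I) z r = esym I z r + z i * esym I z (r - 1)"
proof (cases "r \<le> 0")
  case True
  have "{S. S \<subseteq> insert i I \<and> card S = 0} = {{}}" "{S. S \<subseteq> I \<and> card S = 0} = {{}}"
    using assms(1) by (auto intro: finite_subset simp: card_eq_0_iff dest: finite_subset[of _ "insert i I"] finite_subset[of _ I])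
  then show ?thesis using True by (auto simp: esym_def)
next
  case False
  then obtain m where r: "r = int (Suc m)" by (metis not_le pos_int_cases Suc_pred')
  let ?A = "\<lambda>m. {S. S \<subseteq> I \<and> card S = m}"
  have fin: "finite (?A m)" for m using assms(1) by simp
  have U: "{S. S \<subseteq> insert i I \<and> card S = Suc m} = ?A (Suc m) \<union> insert i ` ?A m" (is "?L = ?R")
  proof (intro set_eqI iffI)
    fix S assume S: "S \<in> ?L"
    have fS: "finite S" using S assms(1) by (auto intro: finite_subset)
    show "S \<in> ?R"
    proof (cases "i \<in> S")
      case True
      then have "S = insert i (S - {i})" by auto
      moreover have "S - {i} \<in> ?A m" using S fS True by (auto simp: card_Diff_singleton)
      ultimately show ?thesis by blast
    next
      case False
      then show ?thesis using S by auto
    qed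
  next
    fix S assume "S \<in> ?R"
    then show "S \<in> ?L"
    proof
      assume "S \<in> insert i ` ?A m"
      then obtain T where T: "S = insert i T" "T \<subseteq> I" "card T = m" by auto
      then have "finite T" "i \<notin> T" using assms by (auto intro: finite_subset)
      then show ?thesis using T by auto
    qed auto
  qed
  have inj: "inj_on (insert i) (?A m)" using assms(2) by (auto simp: inj_on_def insert_ident)
  have "(\<Sum>S\<in>insert i ` ?A m. \<Prod>j\<in>S. z j) = (\<Sum>S\<in>?A m. z i * (\<Prod>j\<in>S. z j))"
  proof (rule sum.reindex_cong[OF inj])
    fix S assume "S \<in> ?A m"
    then have "finite S" "i \<notin> S" using assms by (auto intro: finite_subset)
    then show "(\<Prod>j\<in>insert i S. z j) = z i * (\<Prod>j\<in>S. z j)" by simp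
  qed simp
  then have "(\<Sum>S\<in>?L. \<Prod>j\<in>S. z j) = (\<Sum>S\<in>?A (Suc m). \<Prod>j\<in>S. z j) + z i * (\<Sum>S\<in>?A m. \<Prod>j\<in>S. z j)"
    unfolding U by (subst sum.union_disjoint) (use fin assms in \<open>auto simp: sum_distrib_left\<close>)
  moreover have "nat r = Suc m" "nat (r - 1) = m" "\<not> r < 0" "\<not> r - 1 < 0" by (simp_all add: r)
  ultimately show ?thesis by (simp only: esym_def if_False)
qed

lemma esym_empty: "esym {} z r = (if r = 0 then 1 else 0)"
proof (cases "r = 0")
  case True
  have e: "{S. S \<subseteq> {} \<and> card S = nat 0} = {{}}" by auto
  show ?thesis unfolding True esym_def e by simp
next
  case False
  then have "{S. S \<subseteq> {} \<and> card S = nat r} = {}" if "\<not> r < 0" using that by auto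
  then have "esym {} z r = 0" unfolding esym_def by (metis sum.empty)
  then show ?thesis using False by simp
qed

text \<open>With \<open>j\<close> measured from the middle, \<open>e_mid n x j\<close> is the coefficient of \<open>z\<^sup>j\<close> in
  \<open>\<Prod>\<^sub>i (x\<^sub>i + 1/x\<^sub>i + z + 1/z)\<close>.\<close>

definition e_mid :: "nat \<Rightarrow> (nat \<Rightarrow> 'a::field) \<Rightarrow> int \<Rightarrow> 'a" where
  "e_mid n x j = e_dot n x (int n - j)"

lemma e_mid_0: "e_mid 0 x j = (if j = 0 then 1 else 0)"
  by (simp add: e_mid_def e_dot_def esym_empty Plus_def)

lemma e_mid_Suc:
  assumes "x (Suc n) \<noteq> 0"
  shows "e_mid (Suc n) x j = (x (Suc n) + inverse (x (Suc n))) * e_mid n x j + e_mid n x (j - 1) + e_mid n x (j + 1)"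
proof -
  have S: "{1..Suc n} <+> {1..Suc n} = insert (Inl (Suc n)) (insert (Inr (Suc n)) ({1..n} <+> {1..n}))"
    by (auto simp: Plus_def)
  \<comment> \<open>The two new variables have product 1, so together they contribute
    \<open>1 + (x + 1/x) z + z^2\<close> to the generating function.\<close>
  have "e_dot (Suc n) x r = e_dot n x r + (x (Suc n) + inverse (x (Suc n))) * e_dot n x (r - 1) + e_dot n x (r - 2)" for r
    unfolding e_dot_def S using assms
    by (subst esym_insert, auto simp: Plus_def)+ (simp add: algebra_simps)
  from this[of "int (Suc n) - j"] show ?thesis
    by (simp add: e_mid_def algebra_simps)
qed

lemma e_mid_eq_0:
  assumes "\<And>i. i \<in> {1..n} \<Longrightarrow> x i \<noteq> 0" "\<bar>j\<bar> > int n"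
  shows "e_mid n x j = 0"
  using assms
proof (induction n arbitrary: j)
  case (Suc n)
  then show ?case by (simp add: e_mid_Suc)
qed (simp add: e_mid_0)

text \<open>The generating product is unchanged when \<open>z\<close> is replaced by
  \<open>1/z\<close>.\<close>

lemma e_mid_minus:
  assumes "\<And>i. i \<in> {1..n} \<Longrightarrow> x i \<noteq> 0"
  shows "e_mid n x (- j) = e_mid n x j"
  using assms
proof (induction n arbitrary: j)
  case (Suc n)
  have "e_mid n x (- j - 1) = e_mid n x (j + 1)" "e_mid n x (- j + 1) = e_mid n x (j - 1)"
    using Suc.IH[of "j + 1"] Suc.IH[of "j - 1"] Suc.prems by auto
  then show ?case using Suc by (simp add: e_mid_Suc)
qed (simp add: e_mid_0)

section \<open>Theta weights and the continuous Hermite functional\<close>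

definition theta :: "'a::field \<Rightarrow> int \<Rightarrow> 'a" where
  "theta t p = (if even p then 1 else - 1) * t powi (p * (p - 1) div 2)"

text \<open>For the functional \<open>z\<^bsup>2p\<^esup> \<mapsto> theta t p\<close>, \<open>z\<^bsup>2p+1\<^esup> \<mapsto> 0\<close>, and the continuous
  \<open>t\<close>-Hermite polynomial \<open>H\<^sub>k(z + 1/z)\<close>, this is the value at \<open>z\<^bsup>2p-k\<^esup> H\<^sub>k\<close>; the product form
  is the \<open>t\<close>-binomial theorem, and its vanishing at \<open>2p = k > 0\<close> is the orthogonality of
  \<open>H\<^sub>k\<close> to \<open>1\<close>.\<close>

definition theta_hermite :: "'a::field \<Rightarrow> nat \<Rightarrow> int \<Rightarrow> 'a" where
  "theta_hermite t k p = theta t p * (\<Prod>l<k. 1 - t powi (int l + 1 - p))"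

lemma theta_step: 
  assumes "t \<noteq> 0"
  shows "theta t p = - (theta t (p - 1) * t powi (p - 1))"
proof -
  have "p * (p - 1) = (p - 1) * (p - 1 - 1) + 2 * (p - 1)" by (simp add: algebra_simps)
  then have "p * (p - 1) div 2 = (p - 1) * (p - 1 - 1) div 2 + (p - 1)" by simp
  then show ?thesis using assms by (simp add: theta_def power_int_add)
qed

text \<open>This is the recurrence \<open>H_{k+1} = v H_k - (1 - t^k) H_{k-1}\<close> with
  \<open>v = z + 1/z\<close>, multiplied by \<open>z^(2p-k-1)\<close>. At \<open>k = 0\<close> the
  last coefficient vanishes and hides the truncated subtraction.\<close>

lemma theta_hermite_step:
  assumes "t \<noteq> 0"
  shows "theta_hermite t (Suc k) p =
    theta_hermite t k (p - 1) + theta_hermite t k p - (1 - t ^ k) * theta_hermite t (k - 1) (p - 1)"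
proof -
  \<comment> \<open>With these names the powers of \<open>t\<close> become monomials, tied together
    by \<open>P * Q = 1\<close> and \<open>t ^ k = P * R\<close>.\<close>
  define U P Q where "U = theta t (p - 1)" "P = t powi (p - 1)" "Q = t powi (1 - p)"
  have PQ: "P * Q = 1" using assms unfolding U_P_Q_def by (simp add: power_int_add[symmetric])
  have th: "theta t p = - (U * P)" unfolding U_P_Q_def by (rule theta_step[OF assms])
  show ?thesis
  proof (cases k)
    case 0
    then show ?thesis
      using PQ th by (simp add: theta_hermite_def U_P_Q_def[symmetric] algebra_simps)
  next
    case (Suc m)
    define A where "A = (\<Prod>l<m. 1 - t powi (int l + 2 - p))"
    define R where "R = t powi (int m + 2 - p)"
    have A': "(\<Prod>l<m. 1 - t powi (int (Suc l) + 1 - p)) = A"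
      "(\<Prod>l<m. 1 - t powi (int l + 1 - (p - 1))) = A"
      unfolding A_def by (rule prod.cong; simp add: algebra_simps)+
    have h1: "theta_hermite t (Suc k) p = - (U * P) * ((1 - Q) * (A * (1 - R)))"
      unfolding theta_hermite_def th Suc prod.lessThan_Suc_shift[of _ "Suc m"]
      unfolding prod.lessThan_Suc A' by (simp add: U_P_Q_def R_def algebra_simps)
    have h2: "theta_hermite t k p = - (U * P) * ((1 - Q) * A)"
      unfolding theta_hermite_def th Suc prod.lessThan_Suc_shift A' by (simp add: U_P_Q_def)
    have h3: "theta_hermite t k (p - 1) = U * (A * (1 - R))"
      unfolding theta_hermite_def Suc prod.lessThan_Suc A' by (simp add: U_P_Q_def R_def algebra_simps)
    have h4: "theta_hermite t (k - 1) (p - 1) = U * A"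
      unfolding theta_hermite_def Suc diff_Suc_1 A' U_P_Q_def ..
    have "P * R = t powi (int k)"
      using assms unfolding U_P_Q_def R_def Suc by (simp add: power_int_add[symmetric] algebra_simps)
    then have h5: "t ^ k = P * R" by simp
    show ?thesis unfolding h1 h2 h3 h4 h5 using PQ by algebra
  qed
qed

lemma theta_hermite_at_half: "theta_hermite t k p = 0" if "int k = 2 * p" "k \<noteq> 0"
proof -
  \<comment> \<open>The factor at \<open>l = p - 1\<close> is \<open>1 - t powi 0\<close>.\<close>
  have "nat (p - 1) < k" "int (nat (p - 1)) = p - 1" using that by auto
  then show ?thesis unfolding theta_hermite_def
    by (auto intro!: bexI[of _ "nat (p - 1)"])
qed

lemma sum_shift_int:
  fixes h :: "int \<Rightarrow> 'a::comm_monoid_add"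
  assumes "h (- int N - 1) = 0" "h (int N) = 0"
  shows "(\<Sum>p\<in>{- int N..int N}. h (p - 1)) = (\<Sum>p\<in>{- int N..int N}. h p)"
proof -
  have "(\<Sum>p\<in>{- int N..int N}. h (p - 1)) = (\<Sum>p\<in>{- int N - 1..int N - 1}. h p)"
    by (rule sum.reindex_bij_witness[of _ "\<lambda>p. p + 1" "\<lambda>p. p - 1"]) auto
  also have "\<dots> = (\<Sum>p\<in>{- int N - 1..int N}. h p)"
    by (rule sum.mono_neutral_left) (auto, metis assms(2) linorder_not_less zle_diff1_eq order_antisym)
  also have "\<dots> = (\<Sum>p\<in>{- int N..int N}. h p)"
    by (rule sum.mono_neutral_right) (auto, metis assms(1) diff_add_cancel order_antisym zle_diff1_eq not_le)
  finally show ?thesis .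
qed

text \<open>Both sides apply the functional to \<open>H_k\<close> times a product, with factors
  \<open>x_i + 1/x_i + v\<close> on the left and \<open>x_i + 1/x_i - v\<close> in
  \<open>asc_moment\<close>. The functional is even in \<open>v\<close> and \<open>H_k\<close> has
  the parity of \<open>k\<close>, hence the sign. \<open>N\<close> truncates a finitely supported
  sum.\<close>

lemma theta_sum_eq_asc_moment:
  assumes "t \<noteq> 0" "\<And>i. i \<in> {1..n} \<Longrightarrow> x i \<noteq> 0" "n + k \<le> N"
  shows "(\<Sum>p\<in>{- int N..int N}. theta_hermite t k p * e_mid n x (2 * p - int k)) =
     (- 1) ^ k * asc_moment t 0 0 x n k"
  using assms(2,3)
proof (induction n arbitrary: k)
  case 0
  show ?case
  proof (cases "k = 0")
    case True
    have "(\<Sum>p\<in>{- int N..int N}. theta_hermite t k p * e_mid 0 x (2 * p - int k)) =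
      (\<Sum>p\<in>{0}. theta_hermite t k p * e_mid 0 x (2 * p - int k))"
      by (rule sum.mono_neutral_right) (auto simp: e_mid_0 True)
    then show ?thesis by (simp add: True e_mid_0 theta_hermite_def theta_def)
  next
    case False
    \<comment> \<open>Only \<open>2 * p = k\<close> meets the support of \<open>e_mid 0\<close>, and
      there orthogonality gives zero.\<close>
    then have "theta_hermite t k p * e_mid 0 x (2 * p - int k) = 0" for p
      by (auto simp: e_mid_0 theta_hermite_at_half)
    then show ?thesis using False by (simp del: mult_eq_0_iff)
  qed
next
  case (Suc n)
  let ?u = "x (Suc n) + inverse (x (Suc n))"
  let ?I = "{- int N..int N}"
  let ?f = "e_mid n x"
  let ?h = "theta_hermite t"
  let ?W = "\<lambda>k. \<Sum>p\<in>?I. ?h k p * ?f (2 * p - int k)"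
  have f0: "?f j = 0" if "\<bar>j\<bar> > int n" for j
    by (rule e_mid_eq_0[OF _ that]) (use Suc.prems in auto)
  have IH: "?W k = (- 1) ^ k * asc_moment t 0 0 x n k" if "n + k \<le> N" for k
    using Suc.IH[OF _ that] Suc.prems by auto
  have shift1: "(\<Sum>p\<in>?I. ?h k (p - 1) * ?f (2 * p - int k - 1)) = (\<Sum>p\<in>?I. ?h k p * ?f (2 * p - int k + 1))"
    using sum_shift_int[of "\<lambda>p. ?h k p * ?f (2 * p - int k + 1)" N] Suc.prems(2)
    by (simp add: f0 algebra_simps)
  have shift2: "(\<Sum>p\<in>?I. (1 - t ^ k) * ?h (k - 1) (p - 1) * ?f (2 * p - int k - 1)) = (1 - t ^ k) * ?W (k - 1)"
  proof (cases k)
    case (Suc m)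
    have "(\<Sum>p\<in>?I. ?h m (p - 1) * ?f (2 * p - int k - 1)) = ?W m"
      using sum_shift_int[of "\<lambda>p. ?h m p * ?f (2 * p - int m)" N] Suc.prems(2)
      by (simp add: f0 Suc algebra_simps)
    then have W: "?W (k - 1) = (\<Sum>p\<in>?I. ?h m (p - 1) * ?f (2 * p - int k - 1))" by (simp add: Suc)
    show ?thesis unfolding W sum_distrib_left by (simp add: Suc mult.assoc)
  qed simp
  have "?W (Suc k) = (\<Sum>p\<in>?I. ?h k (p - 1) * ?f (2 * p - int k - 1)) + (\<Sum>p\<in>?I. ?h k p * ?f (2 * p - int k - 1)) -
       (\<Sum>p\<in>?I. (1 - t ^ k) * ?h (k - 1) (p - 1) * ?f (2 * p - int k - 1))"
    unfolding theta_hermite_step[OF assms(1)] sum.distrib[symmetric] sum_subtractf[symmetric]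
    by (rule sum.cong) (simp_all add: algebra_simps)
  then have W: "?W (Suc k) = (\<Sum>p\<in>?I. ?h k p * ?f (2 * p - int k + 1)) + (\<Sum>p\<in>?I. ?h k p * ?f (2 * p - int k - 1)) - (1 - t ^ k) * ?W (k - 1)"
    unfolding shift1 shift2 .
  have "(\<Sum>p\<in>?I. ?h k p * e_mid (Suc n) x (2 * p - int k)) =
     ?u * ?W k + (\<Sum>p\<in>?I. ?h k p * ?f (2 * p - int k - 1)) + (\<Sum>p\<in>?I. ?h k p * ?f (2 * p - int k + 1))"
    unfolding sum_distrib_left sum.distrib[symmetric]
    by (rule sum.cong) (use Suc.prems(1) in \<open>simp_all add: e_mid_Suc algebra_simps\<close>)
  also have "\<dots> = ?u * ?W k + ?W (Suc k) + (1 - t ^ k) * ?W (k - 1)"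
    unfolding W by (simp add: algebra_simps)
  also have "\<dots> = (- 1) ^ k * asc_moment t 0 0 x (Suc n) k"
  proof -
    \<comment> \<open>The bound passes to \<open>Suc k\<close> because one variable has been
      removed.\<close>
    have le: "n + k \<le> N" "n + Suc k \<le> N" "n + (k - 1) \<le> N" using Suc.prems(2) by auto
    show ?thesis unfolding IH[OF le(1)] IH[OF le(2)] IH[OF le(3)]
      by (cases k) (simp_all add: jacobi_def algebra_simps)
  qed
  finally show ?case .
qed

text \<open>Odd indices are written \<open>1 - 2 * y\<close> because the theta weights at
  \<open>2 * y\<close> and \<open>1 - 2 * y\<close> differ only in sign. At
  \<open>y = - int M\<close> this reaches \<open>2 * int M + 1\<close>, one beyond the range, hence
  the hypothesis.\<close>

lemma sum_even_odd_int:
  fixes h :: "int \<Rightarrow> 'a::comm_monoid_add"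
  assumes "h (2 * int M + 1) = 0"
  shows "(\<Sum>p\<in>{- int (2 * M)..int (2 * M)}. h p) = (\<Sum>y\<in>{- int M..int M}. h (2 * y) + h (1 - 2 * y))"
proof -
  let ?I = "{- int M..int M}"
  have U: "{- int (2 * M)..int (2 * M) + 1} = (\<lambda>y. 2 * y) ` ?I \<union> (\<lambda>y. 1 - 2 * y) ` ?I" (is "?L = ?R")
  proof (intro set_eqI iffI)
    fix p assume p: "p \<in> ?L"
    show "p \<in> ?R"
    proof (cases "even p")
      case True
      then obtain y where "p = 2 * y" by blast
      then show ?thesis using p by auto
    next
      case False
      then obtain y where "p = 2 * y + 1" using oddE by blast
      then have "p = 1 - 2 * (- y)" "- y \<in> ?I" using p by auto
      then show ?thesis by blast
    qed
  qed auto
  have "(\<Sum>p\<in>{- int (2 * M)..int (2 * M)}. h p) = (\<Sum>p\<in>?L. h p)"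
    by (rule sum.mono_neutral_left) (use assms in \<open>auto simp: not_le\<close>, 
       metis add.commute add_le_same_cancel1 order_antisym zle_add1_eq_le not_le)
  also have "\<dots> = (\<Sum>p\<in>(\<lambda>y. 2 * y) ` ?I. h p) + (\<Sum>p\<in>(\<lambda>y. 1 - 2 * y) ` ?I. h p)"
    unfolding U by (rule sum.union_disjoint) (auto, presburger)
  also have "\<dots> = (\<Sum>y\<in>?I. h (2 * y)) + (\<Sum>y\<in>?I. h (1 - 2 * y))"
    by (intro arg_cong2[of _ _ _ _ "(+)"]; subst sum.reindex) (auto simp: inj_on_def)
  finally show ?thesis by (simp add: sum.distrib)
qed

lemma theta_double:
  "theta t (2 * y) = t powi (2 * y\<^sup>2 - y)" "theta t (1 - 2 * y) = - (t powi (2 * y\<^sup>2 - y))"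
proof -
  have "2 * y * (2 * y - 1) = 2 * (2 * y\<^sup>2 - y)" "(1 - 2 * y) * (1 - 2 * y - 1) = 2 * (2 * y\<^sup>2 - y)"
    by (simp_all add: power2_eq_square algebra_simps)
  then show "theta t (2 * y) = t powi (2 * y\<^sup>2 - y)" "theta t (1 - 2 * y) = - (t powi (2 * y\<^sup>2 - y))"
    by (simp_all add: theta_def)
qed

lemma asc_moment_eq_theta_sum:
  fixes x :: "nat \<Rightarrow> 'a::field"
  assumes "t \<noteq> 0" "\<And>i. i \<in> {1..n} \<Longrightarrow> x i \<noteq> 0"
  shows "asc_moment t 0 0 x n 0 =
    (\<Sum>y\<in>{- int n..int n}. t powi (2 * y\<^sup>2 - y) * (e_mid n x (4 * y) - e_mid n x (4 * y - 2)))"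
proof -
  have "asc_moment t 0 0 x n 0 = (\<Sum>p\<in>{- int (2 * n)..int (2 * n)}. theta t p * e_mid n x (2 * p))"
    using theta_sum_eq_asc_moment[OF assms, where k = 0 and N = "2 * n"] by (simp add: theta_hermite_def)
  also have "\<dots> = (\<Sum>y\<in>{- int n..int n}. theta t (2 * y) * e_mid n x (2 * (2 * y)) +
      theta t (1 - 2 * y) * e_mid n x (2 * (1 - 2 * y)))"
  proof (rule sum_even_odd_int)
    have "e_mid n x (2 * (2 * int n + 1)) = 0" by (rule e_mid_eq_0[OF assms(2)]) auto
    then show "theta t (2 * int n + 1) * e_mid n x (2 * (2 * int n + 1)) = 0" by (simp only: mult_zero_right)
  qed
  also have "\<dots> = (\<Sum>y\<in>{- int n..int n}. t powi (2 * y\<^sup>2 - y) * (e_mid n x (4 * y) - e_mid n x (4 * y - 2)))"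
  proof (rule sum.cong)
    fix y
    have "e_mid n x (2 * (1 - 2 * y)) = e_mid n x (4 * y - 2)"
      using e_mid_minus[OF assms(2), where j = "4 * y - 2"] by (simp add: algebra_simps)
    then show "theta t (2 * y) * e_mid n x (2 * (2 * y)) + theta t (1 - 2 * y) * e_mid n x (2 * (1 - 2 * y)) =
        t powi (2 * y\<^sup>2 - y) * (e_mid n x (4 * y) - e_mid n x (4 * y - 2))"
      unfolding theta_double by (simp add: right_diff_distrib)
  qed simp
  finally show ?thesis .
qed

text \<open>Polynomial dependence on the base serves to reach \<open>t = 0\<close>, where the
  argument with negative powers breaks down.\<close>

lemma poly_fun_asc_moment_base: "\<exists>m. poly_fun m (\<lambda>t. asc_moment t 0 0 x n k)"
proof (induction n arbitrary: k)
  case 0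
  show ?case using poly_fun_const by force
next
  case (Suc n)
  obtain a b c where
    a: "poly_fun a (\<lambda>t. asc_moment t 0 0 x n k)" and
    b: "poly_fun b (\<lambda>t. asc_moment t 0 0 x n (Suc k))" and
    c: "poly_fun c (\<lambda>t. asc_moment t 0 0 x n (k - 1))"
    using Suc.IH by metis
  have lam: "poly_fun (k + c) (\<lambda>t. (1 - t ^ k) * asc_moment t 0 0 x n (k - 1))"
    by (intro poly_fun_mult poly_fun_diff poly_fun_power c poly_fun_mono[OF poly_fun_const]) simp
  have "poly_fun (a + b + (k + c)) (\<lambda>t. (x (Suc n) + inverse (x (Suc n))) * asc_moment t 0 0 x n k -
      (asc_moment t 0 0 x n (Suc k) + (1 - t ^ k) * asc_moment t 0 0 x n (k - 1)))"
    by (intro poly_fun_diff poly_fun_add poly_fun_cmult poly_fun_mono[OF a] poly_fun_mono[OF b]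
          poly_fun_mono[OF lam]) auto
  then show ?case by (auto simp: jacobi_def)
qed

text \<open>The exponents \<open>2 * y\<^sup>2 - y\<close> are nonnegative, so both sides are
  polynomials in \<open>t\<close> and agreement for nonzero \<open>t\<close> suffices.\<close>

lemma asc_moment_eq_theta_sum':
  fixes x :: "nat \<Rightarrow> 'a::field_char_0"
  assumes "\<And>i. i \<in> {1..n} \<Longrightarrow> x i \<noteq> 0"
  shows "asc_moment t 0 0 x n 0 =
    (\<Sum>y\<in>{- int n..int n}. t powi (2 * y\<^sup>2 - y) * (e_mid n x (4 * y) - e_mid n x (4 * y - 2)))"
    (is "_ = ?R t")
proof -
  obtain m where m: "poly_fun m (\<lambda>t. asc_moment t 0 0 x n 0)"
    using poly_fun_asc_moment_base by blast
  have "poly_fun (nat (2 * (int n)\<^sup>2 + int n)) ?R"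
  proof (intro poly_fun_sum)
    fix y assume y: "y \<in> {- int n..int n}"
    have "\<bar>y\<bar>\<^sup>2 \<le> (int n)\<^sup>2" using y by (intro power_mono) auto
    then have le: "2 * y\<^sup>2 - y \<le> 2 * (int n)\<^sup>2 + int n" using y by auto
    have ge: "0 \<le> 2 * y\<^sup>2 - y"
    proof -
      have "y \<le> y\<^sup>2" using self_le_power[of y 2] zero_le_power2[of y] by linarith
      then show ?thesis using zero_le_power2[of y] by linarith
    qed
    have "poly_fun (nat (2 * y\<^sup>2 - y) + 0)
       (\<lambda>t. t ^ nat (2 * y\<^sup>2 - y) * (e_mid n x (4 * y) - e_mid n x (4 * y - 2)))"
      by (intro poly_fun_mult poly_fun_power poly_fun_const)
    then show "poly_fun (nat (2 * (int n)\<^sup>2 + int n))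
       (\<lambda>t. t powi (2 * y\<^sup>2 - y) * (e_mid n x (4 * y) - e_mid n x (4 * y - 2)))"
      using ge le by (auto simp: power_int_def intro: poly_fun_mono)
  qed
  then show ?thesis
    by (rule poly_fun_eq_generic[OF m, of _ ?R "{0}"]) (use assms in \<open>auto intro!: asc_moment_eq_theta_sum\<close>)
qed

text \<open>Here \<open>(1 - t\<^sup>k)(1 + r\<^sup>2 t\<^bsup>k-1\<^esup>) = 1 - t\<^bsup>2k\<^esup>\<close>: the parameters \<open>\<plusminus>\<surd>t\<close> give the
  Hermite case to base \<open>t\<^sup>2\<close>.\<close>

lemma asc_moment_opposite:
  assumes "r\<^sup>2 = t"
  shows "asc_moment t r (- r) x n k = asc_moment (t\<^sup>2) 0 0 x n k"
proof (induction n arbitrary: k)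
  case (Suc n)
  have "(1 - t ^ k) * (1 - r * (- r) * t ^ (k - 1)) = 1 - (t\<^sup>2) ^ k"
  proof (cases k)
    case (Suc m)
    have e: "1 - r * (- r) * t ^ m = 1 + t ^ Suc m" using assms by (simp add: power2_eq_square)
    show ?thesis unfolding Suc diff_Suc_1 e
      by (simp add: power2_eq_square power_mult_distrib algebra_simps)
  qed simp
  then show ?case by (simp add: jacobi_def Suc.IH)
qed simp

subsection \<open>Reduction of the Hall--Littlewood polynomial\<close>

text \<open>\<open>hyperoct_act\<close> inverts by position, \<open>flip\<close> by variable; for
  fixed \<open>\<pi>\<close>, replacing \<open>E\<close> by its image under \<open>\<pi>\<close>
  translates between them. The permutation sum can then be taken first.\<close>

lemma sum_hyperoct:
  "(\<Sum>w\<in>hyperoct n. hyperoct_act w f x) =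
     (\<Sum>E\<in>Pow {1..n}. \<Sum>\<pi> | \<pi> permutes {1..n}. f (\<lambda>i. flip E x (\<pi> i)))"
proof -
  have "(\<Sum>w\<in>hyperoct n. hyperoct_act w f x) =
     (\<Sum>\<pi> | \<pi> permutes {1..n}. \<Sum>E\<in>Pow {1..n}. hyperoct_act (\<pi>, E) f x)"
    unfolding hyperoct_def by (simp add: sum.cartesian_product)
  also have "\<dots> = (\<Sum>\<pi> | \<pi> permutes {1..n}. \<Sum>E\<in>Pow {1..n}. f (\<lambda>i. flip E x (\<pi> i)))"
  proof (rule sum.cong)
    fix \<pi> assume "\<pi> \<in> {\<pi>. \<pi> permutes {1..n}}"
    then have p: "\<pi> permutes {1..n}" by simp
    have img: "\<pi> ` E \<subseteq> {1..n}" "inv \<pi> ` E \<subseteq> {1..n}" if "E \<subseteq> {1..n}" for E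
      using image_mono[OF that, of \<pi>] image_mono[OF that, of "inv \<pi>"]
        permutes_image[OF p] permutes_image[OF permutes_inv[OF p]] by auto
    have mem: "\<pi> i \<in> \<pi> ` E \<longleftrightarrow> i \<in> E" for i E
      using permutes_inj[OF p] by (simp add: inj_image_mem_iff)
    show "(\<Sum>E\<in>Pow {1..n}. hyperoct_act (\<pi>, E) f x) = (\<Sum>E\<in>Pow {1..n}. f (\<lambda>i. flip E x (\<pi> i)))"
    proof (rule sum.reindex_bij_witness[of _ "image (inv \<pi>)" "image \<pi>"])
      fix E assume "E \<in> Pow {1..n}"
      then show "\<pi> ` E \<in> Pow {1..n}" "inv \<pi> ` E \<in> Pow {1..n}" using img by simp_all
      show "inv \<pi> ` \<pi> ` E = E" "\<pi> ` inv \<pi> ` E = E"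
        by (simp_all add: image_image permutes_inverses[OF p])
      show "f (\<lambda>i. flip (\<pi> ` E) x (\<pi> i)) = hyperoct_act (\<pi>, E) f x"
        unfolding hyperoct_act_def flip_def mem by (simp only: fst_conv snd_conv)
    qed
  qed simp
  also have "\<dots> = (\<Sum>E\<in>Pow {1..n}. \<Sum>\<pi> | \<pi> permutes {1..n}. f (\<lambda>i. flip E x (\<pi> i)))"
    by (rule sum.swap)
  finally show ?thesis .
qed

text \<open>For a column all exponents are equal, so the factors other than
  \<open>(t * x i - x j) / (x i - x j)\<close> form symmetric products and leave the sum over
  permutations.\<close>

lemma hl_summand_column:
  assumes "\<pi> permutes {1..n}"
  shows "hl_summand n (replicate n 1) t s1 s2 (\<lambda>i. x (\<pi> i)) =
    signed_term t s1 s2 {1..n} x *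
    pair_prod (\<lambda>i j. (t * x (\<pi> i) - x (\<pi> j)) / (x (\<pi> i) - x (\<pi> j))) {1..n}"
proof -
  let ?x = "\<lambda>i. x (\<pi> i)"
  have "(\<Prod>i\<in>{1..n}. ?x i powi (- int (part (replicate n 1) i)) *
      ((1 - s1 * ?x i) * (1 - s2 * ?x i) / (1 - (?x i)\<^sup>2))) = (\<Prod>i\<in>{1..n}. c_factor s1 s2 (?x i))"
  proof (rule prod.cong)
    fix i assume i: "i \<in> {1..n}"
    then have "part (replicate n 1) i = 1" by (auto simp: part_def)
    then show "?x i powi (- int (part (replicate n 1) i)) * ((1 - s1 * ?x i) * (1 - s2 * ?x i) / (1 - (?x i)\<^sup>2)) = c_factor s1 s2 (?x i)"
      by (simp add: c_factor_def power_int_minus divide_inverse mult_ac)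
  qed simp
  also have "\<dots> = (\<Prod>i\<in>{1..n}. c_factor s1 s2 (x i))"
    by (rule prod.permute[OF assms, unfolded o_def, symmetric])
  finally have 1: "(\<Prod>i\<in>{1..n}. ?x i powi (- int (part (replicate n 1) i)) *
      ((1 - s1 * ?x i) * (1 - s2 * ?x i) / (1 - (?x i)\<^sup>2))) = (\<Prod>i\<in>{1..n}. c_factor s1 s2 (x i))" .
  have "(\<Prod>i\<in>{1..n}. \<Prod>j\<in>{i<..n}.
        ((t * ?x i - ?x j) * (1 - t * ?x i * ?x j)) / ((?x i - ?x j) * (1 - ?x i * ?x j))) =
     pair_prod (\<lambda>i j. (t * ?x i - ?x j) / (?x i - ?x j)) {1..n} * pair_prod (\<lambda>i j. pair_factor t (?x i) (?x j)) {1..n}"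
    unfolding pair_prod_atLeastAtMost prod.distrib[symmetric] pair_factor_def times_divide_times_eq ..
  also have "pair_prod (\<lambda>i j. pair_factor t (?x i) (?x j)) {1..n} = pair_prod (\<lambda>i j. pair_factor t (x i) (x j)) {1..n}"
    by (rule pair_prod_permutes[OF assms]) (rule pair_factor_commute)
  finally have 2: "(\<Prod>i\<in>{1..n}. \<Prod>j\<in>{i<..n}.
        ((t * ?x i - ?x j) * (1 - t * ?x i * ?x j)) / ((?x i - ?x j) * (1 - ?x i * ?x j))) =
     pair_prod (\<lambda>i j. (t * ?x i - ?x j) / (?x i - ?x j)) {1..n} * pair_prod (\<lambda>i j. pair_factor t (x i) (x j)) {1..n}" .
  show ?thesis unfolding hl_summand_def 1 2 signed_term_def by (simp only: mult_ac)
qed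

text \<open>The permutation sum equals \<open>hl_v\<close>, nonzero by the condition on powers of
  \<open>t\<close>, and cancels it. The other normalizing factor is an empty product, as the column
  has \<open>n\<close> parts.\<close>

lemma P_BC_column:
  assumes "n \<ge> 1" "regular_on {1..n} x" "\<forall>k\<in>{1..n}. t ^ k \<noteq> 1"
  shows "P_BC n (replicate n 1) x t s1 s2 = signed_sum t s1 s2 {1..n} x"
proof -
  let ?v = "qpoch t t n / (1 - t) ^ n"
  have t1: "t \<noteq> 1" using assms(1,3) by force
  have "qpoch t t n \<noteq> 0"
    unfolding qpoch_def using assms(3) by (auto simp flip: power_Suc)
  then have v: "?v \<noteq> 0" using t1 by simp
  have hv: "hl_v n (replicate n 1) t = ?v"
  proof -
    have "count_list (replicate n (1::nat)) 1 = n" by (induction n) auto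
    then show ?thesis using assms(1) by (simp add: hl_v_def qpoch_def)
  qed
  have "(\<Sum>w\<in>hyperoct n. hyperoct_act w (hl_summand n (replicate n 1) t s1 s2) x) =
     (\<Sum>E\<in>Pow {1..n}. signed_term t s1 s2 {1..n} (flip E x) * ?v)"
    unfolding sum_hyperoct
  proof (rule sum.cong)
    fix E
    have inj: "inj_on (flip E x) {1..n}"
      using regular_on_flip[OF assms(2), of E] by (auto simp: inj_on_def regular_on_def)
    have "(\<Sum>\<pi> | \<pi> permutes {1..n}. hl_summand n (replicate n 1) t s1 s2 (\<lambda>i. flip E x (\<pi> i))) =
       signed_term t s1 s2 {1..n} (flip E x) * (\<Sum>\<pi> | \<pi> permutes {1..n}.
          pair_prod (\<lambda>i j. (t * flip E x (\<pi> i) - flip E x (\<pi> j)) / (flip E x (\<pi> i) - flip E x (\<pi> j))) {1..n})"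
      unfolding sum_distrib_left by (rule sum.cong[OF refl], rule hl_summand_column) simp
    then show "(\<Sum>\<pi> | \<pi> permutes {1..n}. hl_summand n (replicate n 1) t s1 s2 (\<lambda>i. flip E x (\<pi> i))) =
       signed_term t s1 s2 {1..n} (flip E x) * ?v"
      unfolding sum_permutes_pair_prod[OF inj t1] .
  qed simp
  also have "\<dots> = signed_sum t s1 s2 {1..n} x * ?v"
    unfolding signed_sum_def by (rule sum_distrib_right[symmetric])
  finally show ?thesis
    unfolding P_BC_def hv using v by (simp add: qpoch_def)
qed

section \<open>Bilateral sums and the two formulas\<close>

text \<open>\<open>sum'\<close> is zero on infinite support, so injectivity also has to transfer
  finiteness of the support.\<close>

lemma sum'_reindex:
  assumes "inj_on h A"
  shows "sum' f (h ` A) = sum' (\<lambda>y. f (h y)) A"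
proof -
  have "{x \<in> h ` A. f x \<noteq> 0} = h ` {y \<in> A. f (h y) \<noteq> 0}" by auto
  moreover have "inj_on h {y \<in> A. f (h y) \<noteq> 0}"
    using assms by (rule inj_on_subset) auto
  ultimately show ?thesis
    unfolding sum.G_def by (simp add: finite_image_iff sum.reindex)
qed

lemma theta_sum_finite:
  fixes x :: "nat \<Rightarrow> 'a::field"
  assumes "\<And>i. i \<in> {1..n} \<Longrightarrow> x i \<noteq> 0"
  shows "sum' (\<lambda>y::int. t powi (2 * y\<^sup>2 - y) *
             (e_dot n x (int n - 4 * y) - e_dot n x (int n + 2 - 4 * y))) UNIV =
    (\<Sum>y\<in>{- int n..int n}. t powi (2 * y\<^sup>2 - y) * (e_mid n x (4 * y) - e_mid n x (4 * y - 2)))"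
proof -
  have e: "e_dot n x (int n - 4 * y) = e_mid n x (4 * y)"
    "e_dot n x (int n + 2 - 4 * y) = e_mid n x (4 * y - 2)" for y
    by (simp_all add: e_mid_def algebra_simps)
  have z: "e_mid n x (4 * y) = 0 \<and> e_mid n x (4 * y - 2) = 0" if "y \<notin> {- int n..int n}" for y
    using that by (auto intro!: e_mid_eq_0[OF assms])
  show ?thesis
    unfolding e
    by (subst sum.mono_neutral_right'[of "{- int n..int n}"]) (auto simp: z)
qed

theorem lemma4p2:
  fixes n :: nat and x :: "nat \<Rightarrow> 'a::field_char_0" and t :: 'a
  assumes "n \<ge> 1"
    and "\<forall>i\<in>{1..n}. x i \<noteq> 0 \<and> (x i)\<^sup>2 \<noteq> 1"
    and "\<forall>i\<in>{1..n}. \<forall>j\<in>{1..n}. i \<noteq> j \<longrightarrow> x i \<noteq> x j \<and> x i * x j \<noteq> 1"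
    and "\<forall>k\<in>{1..n}. t ^ k \<noteq> 1"
  shows "P_C n (replicate n 1) x t 0 =
           sum' (\<lambda>y::int. t powi (2 * y\<^sup>2 - y) *
             (e_dot n x (int n - 4 * y) - e_dot n x (int n + 2 - 4 * y))) UNIV
       \<and> ((\<exists>r. r\<^sup>2 = t) \<longrightarrow>
         P_C n (replicate n 1) x t t =
           sum' (\<lambda>y::int. t powi (y\<^sup>2 - y) *
             (e_dot n x (int n - 2 * y) - e_dot n x (int n + 2 - 2 * y))) {y. even y})"
proof
  have reg: "regular_on {1..n} x" using assms(2,3) unfolding regular_on_def by blast
  have x0: "x i \<noteq> 0" if "i \<in> {1..n}" for i using assms(2) that by blast
  have PC: "P_C n (replicate n 1) x t s = asc_moment t (SOME r. r\<^sup>2 = s) (- (SOME r. r\<^sup>2 = s)) x n 0" for s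
    unfolding P_C_def Let_def P_BC_column[OF assms(1) reg assms(4)] signed_sum_eq_asc_moment[OF reg] ..
  have theta: "sum' (\<lambda>y::int. s powi (2 * y\<^sup>2 - y) *
      (e_dot n x (int n - 4 * y) - e_dot n x (int n + 2 - 4 * y))) UNIV = asc_moment s 0 0 x n 0" for s
    using trans[OF theta_sum_finite asc_moment_eq_theta_sum'[symmetric]] x0 by blast
  \<comment> \<open>Zero is its own only square root, so both parameters are 0.\<close>
  have "(SOME r :: 'a. r\<^sup>2 = 0) = 0" by simp
  then show "P_C n (replicate n 1) x t 0 =
           sum' (\<lambda>y::int. t powi (2 * y\<^sup>2 - y) *
             (e_dot n x (int n - 4 * y) - e_dot n x (int n + 2 - 4 * y))) UNIV"
    unfolding PC theta by simp
  show "(\<exists>r. r\<^sup>2 = t) \<longrightarrow>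
         P_C n (replicate n 1) x t t =
           sum' (\<lambda>y::int. t powi (y\<^sup>2 - y) *
             (e_dot n x (int n - 2 * y) - e_dot n x (int n + 2 - 2 * y))) {y. even y}"
  proof
    assume "\<exists>r. r\<^sup>2 = t"
    \<comment> \<open>The argument uses only the square of the chosen root, so it covers whichever
      root \<open>SOME\<close> picks.\<close>
    then have r: "(SOME r. r\<^sup>2 = t)\<^sup>2 = t" by (rule someI_ex)
    let ?f = "\<lambda>y::int. t powi (y\<^sup>2 - y) * (e_dot n x (int n - 2 * y) - e_dot n x (int n + 2 - 2 * y))"
    let ?g = "\<lambda>y::int. (t\<^sup>2) powi (2 * y\<^sup>2 - y) * (e_dot n x (int n - 4 * y) - e_dot n x (int n + 2 - 4 * y))"
    \<comment> \<open>Since \<open>(2y)^2 - 2y = 2 (2y^2 - y)\<close>, the second formula is the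
      first one to base \<open>t\<^sup>2\<close>.\<close>
    have fg: "?f (2 * y) = ?g y" for y
    proof -
      have "t powi ((2 * y)\<^sup>2 - 2 * y) = (t\<^sup>2) powi (2 * y\<^sup>2 - y)"
        unfolding power_int_power by (rule arg_cong) (simp add: power2_eq_square algebra_simps)
      then show ?thesis by simp
    qed
    have evens: "{y. even y} = range (\<lambda>y::int. 2 * y)" by (auto elim: evenE)
    have "sum' ?f {y. even y} = sum' ?g UNIV"
      unfolding evens fg[symmetric] by (rule sum'_reindex) (simp add: inj_on_def)
    then show "P_C n (replicate n 1) x t t = sum' ?f {y. even y}"
      unfolding PC asc_moment_opposite[OF r] theta by simp
  qed
qed

end
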